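(* Let $F\in\mathbb{Z}[X]$ be a $*$-symmetric polynomial of even degree $2n$ satisfying: $|F(1)|$, $|F(-1)|$ and $(-1)^nF(1)F(-1)$ are all squares of integers. If neither the multiplicity of $X-1$ nor that of $X+1$ in $F$ equals $1$, then there exists a semisimple isometry, with characteristic polynomial $F$, of an even unimodular $\mathbb{Z}$-lattice of signature $(n,n)$.
   Context: A monic polynomial $F$ with $F(0)\ne0$ is $*$-symmetric if $F(X)=F(0)^{-1}X^{\deg F}F(X^{-1})$. An even unimodular $\mathbb{Z}$-lattice is a free $\mathbb{Z}$-module of finite rank with a nondegenerate symmetric $\mathbb{Z}$-valued bilinear form $b$ with $b(x,x)\in2\mathbb{Z}$ for all $x$ and $\Lambda^\vee=\Lambda$. A semisimple isometry is one diagonalizable over $\mathbb{C}$. *)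

theory Defs
  imports "Jordan_Normal_Form.Char_Poly" Complex_Main
begin

(* For p with p(0) \<noteq> 0, reflect_poly p = X^(deg p) p(X^{-1}). *)
definition star_symmetric :: "'a :: field poly \<Rightarrow> bool" where
  "star_symmetric F \<longleftrightarrow>
     lead_coeff F = 1 \<and> poly F 0 \<noteq> 0 \<and>
     F = Polynomial.smult (inverse (poly F 0)) (reflect_poly F)"

(* After a choice of basis, a free Z-module of rank r with a Z-valued symmetric bilinear form
   is Z^r (carrier_vec r) with its Gram matrix G, where r = dim_row G.  The form extends to
   Q^r and R^r by the same formula, with G mapped into the field. *)
definition gram_form :: "'a :: comm_ring_1 mat \<Rightarrow> 'a vec \<Rightarrow> 'a vec \<Rightarrow> 'a" where
  "gram_form G x y = x \<bullet> (G *\<^sub>v y)"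

definition nondegenerate_form :: "int mat \<Rightarrow> bool" where
  "nondegenerate_form G \<longleftrightarrow>
     (\<forall>x \<in> carrier_vec (dim_row G).
        (\<forall>y \<in> carrier_vec (dim_row G). gram_form G x y = 0) \<longrightarrow> x = 0\<^sub>v (dim_row G))"

definition zlattice :: "int mat \<Rightarrow> bool" where
  "zlattice G \<longleftrightarrow> square_mat G \<and>
     (\<forall>x \<in> carrier_vec (dim_row G). \<forall>y \<in> carrier_vec (dim_row G).
        gram_form G x y = gram_form G y x) \<and>
     nondegenerate_form G"

definition even_zlattice :: "int mat \<Rightarrow> bool" where
  "even_zlattice G \<longleftrightarrow> zlattice G \<and>
     (\<forall>x \<in> carrier_vec (dim_row G). even (gram_form G x x))"

definition integral_vecs :: "nat \<Rightarrow> rat vec set" where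
  "integral_vecs r = map_vec of_int ` (carrier_vec r :: int vec set)"

definition dual_lattice :: "int mat \<Rightarrow> rat vec set" where
  "dual_lattice G =
     {x \<in> carrier_vec (dim_row G).
        \<forall>y \<in> integral_vecs (dim_row G). gram_form (map_mat of_int G) x y \<in> \<int>}"

definition even_unimodular :: "int mat \<Rightarrow> bool" where
  "even_unimodular G \<longleftrightarrow> even_zlattice G \<and> dual_lattice G = integral_vecs (dim_row G)"

(* Numbers of positive and negative diagonal entries in an orthogonal basis of the real
   quadratic space; independent of the basis by Sylvester's law of inertia. *)
definition has_signature :: "int mat \<Rightarrow> nat \<Rightarrow> nat \<Rightarrow> bool" where
  "has_signature G p q \<longleftrightarrow>
     (\<exists>P \<in> carrier_mat (dim_row G) (dim_row G). \<exists>D.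
        invertible_mat P \<and>
        D = transpose_mat P * map_mat real_of_int G * P \<and> diagonal_mat D \<and>
        card {i. i < dim_row G \<and> D $$ (i, i) > 0} = p \<and>
        card {i. i < dim_row G \<and> D $$ (i, i) < 0} = q)"

definition lattice_isometry :: "int mat \<Rightarrow> int mat \<Rightarrow> bool" where
  "lattice_isometry G A \<longleftrightarrow>
     A \<in> carrier_mat (dim_row G) (dim_row G) \<and>
     bij_betw (\<lambda>x. A *\<^sub>v x) (carrier_vec (dim_row G)) (carrier_vec (dim_row G)) \<and>
     (\<forall>x \<in> carrier_vec (dim_row G). \<forall>y \<in> carrier_vec (dim_row G).
        gram_form G (A *\<^sub>v x) (A *\<^sub>v y) = gram_form G x y)"

definition semisimple_endo :: "int mat \<Rightarrow> bool" where
  "semisimple_endo A \<longleftrightarrow>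
     (\<exists>D :: complex mat. similar_mat (map_mat of_int A) D \<and> diagonal_mat D)"

end

theory Submission
  imports Defs "HOL-Computational_Algebra.Polynomial_Factorial"
    "HOL-Computational_Algebra.Fundamental_Theorem_Algebra"
begin

text \<open>
  Everything happens in the orthogonal sum \<open>U\<^sup>n\<close> of \<open>n\<close> hyperbolic planes.

  If \<open>f\<close> is monic with \<open>f(0) = \<plusminus>1\<close> and has simple roots, its companion matrix together with the
  inverse transpose is a semisimple isometry of \<open>L \<oplus> L\<^sup>\<or>\<close> with characteristic polynomial \<open>f f\<^sup>*\<close>.
  Splitting off such factors from a palindromic \<open>F\<close> preserves the square conditions, and leaves a
  polynomial whose roots are simple except for at most double roots at \<open>\<plusminus>1\<close>.

  For such an \<open>F\<close>, write \<open>F(1) = \<delta> a\<^sup>2\<close> and \<open>(-1)\<^sup>n F(-1) = \<delta> b\<^sup>2\<close> with a common sign \<open>\<delta>\<close>. As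
  \<open>a \<equiv> b\<close> modulo 2, one can solve \<open>a = \<alpha> + \<delta>\<beta>\<close>, \<open>b = \<alpha> - \<delta>\<beta>\<close>, and then, with \<open>m = n - 1\<close>,
  \<open>F = (X\<^sup>2 - 1) P + X\<^sup>m (\<alpha>\<beta>(X\<^sup>2 + 1) + \<delta>(\<alpha>\<^sup>2 + \<beta>\<^sup>2) X)\<close> with \<open>P\<close> antipalindromic. A signed permutation of
  a hyperbolic basis composed with an Eichler transvection whose coefficients are \<open>\<alpha>\<close>, \<open>\<beta>\<close> and
  the coefficients of \<open>P\<close> has \<open>F\<close> as characteristic polynomial (this is a Steinberg section for
  \<open>SO(n,n)\<close>); explicit eigenvectors, two of them for a root \<open>\<plusminus>1\<close>, show that it is semisimple.

  If \<open>F(0) = -1\<close>, both \<open>\<plusminus>1\<close> are roots of order at least 2, and \<open>F = (X\<^sup>2 - 1) F'\<close> with \<open>F'\<close>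
  palindromic and vanishing at \<open>\<plusminus>1\<close>; the factor \<open>X\<^sup>2 - 1\<close> is the swap of a hyperbolic plane.
\<close>

section \<open>Diagonalization by eigenvectors\<close>

text \<open>A polynomial in \<open>A\<close> multiplies the coefficient of each eigenvector by its
  value at the eigenvalue, so a relation can be cut down to one eigenspace. There the coordinate
  \<open>k s\<close> is nonzero for \<open>x s\<close> alone, which isolates
  \<open>c s\<close>.\<close>

lemma eigenvectors_independent:
  fixes A :: "'a :: field mat" and x :: "'s \<Rightarrow> nat \<Rightarrow> 'a"
  assumes "finite S"
    and eig: "\<And>s i. s \<in> S \<Longrightarrow> i < N \<Longrightarrow> (\<Sum>j<N. A $$ (i,j) * x s j) = ev s * x s i"
    and nz: "\<And>s. s \<in> S \<Longrightarrow> k s < N \<and> x s (k s) \<noteq> 0"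
    and sep: "\<And>s t. s \<in> S \<Longrightarrow> t \<in> S \<Longrightarrow> s \<noteq> t \<Longrightarrow> ev s = ev t \<Longrightarrow> x t (k s) = 0"
    and zero: "\<And>i. i < N \<Longrightarrow> (\<Sum>s\<in>S. c s * x s i) = 0"
    and "s \<in> S"
  shows "c s = 0"
proof -
  have pow: "(\<Sum>t\<in>S. c t * ev t ^ d * x t i) = 0" if "i < N" for d i
    using that
  proof (induction d arbitrary: i)
    case 0
    then show ?case using zero by simp
  next
    case (Suc d)
    have "(\<Sum>t\<in>S. c t * ev t ^ Suc d * x t i) = (\<Sum>t\<in>S. c t * ev t ^ d * (\<Sum>j<N. A $$ (i,j) * x t j))"
      using Suc.prems by (intro sum.cong) (auto simp: eig)
    also have "\<dots> = (\<Sum>j<N. A $$ (i,j) * (\<Sum>t\<in>S. c t * ev t ^ d * x t j))"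
      by (simp add: sum_distrib_left, subst sum.swap, intro sum.cong refl) (simp add: ac_simps)
    also have "\<dots> = 0" using Suc.IH by simp
    finally show ?case .
  qed
  have pol: "(\<Sum>t\<in>S. c t * poly p (ev t) * x t i) = 0" if "i < N" for p i
  proof -
    have "(\<Sum>t\<in>S. c t * poly p (ev t) * x t i)
        = (\<Sum>d\<le>degree p. coeff p d * (\<Sum>t\<in>S. c t * ev t ^ d * x t i))"
      by (simp add: poly_altdef sum_distrib_left sum_distrib_right, subst sum.swap,
          intro sum.cong refl) (simp add: ac_simps)
    then show ?thesis using pow[OF that] by simp
  qed
  \<comment> \<open>Up to a scalar this projects to the eigenspace of \<open>ev s\<close>: it
    vanishes at every other eigenvalue.\<close>
  define p where "p = (\<Prod>z\<in>ev ` S - {ev s}. [:-z, 1:])"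
  have p0: "poly p (ev t) = 0" if "t \<in> S" "ev t \<noteq> ev s" for t
    unfolding p_def poly_prod using that \<open>finite S\<close> by (intro prod_zero) auto
  have ps: "poly p (ev s) \<noteq> 0"
    unfolding p_def poly_prod using \<open>finite S\<close> by (subst prod_zero_iff) auto
  have "0 = (\<Sum>t\<in>S. c t * poly p (ev t) * x t (k s))"
    using pol nz \<open>s \<in> S\<close> by simp
  also have "\<dots> = (\<Sum>t\<in>S. if t = s then c s * poly p (ev s) * x s (k s) else 0)"
  proof (intro sum.cong refl)
    fix t assume "t \<in> S"
    then show "c t * poly p (ev t) * x t (k s) = (if t = s then c s * poly p (ev s) * x s (k s) else 0)"
      using p0[of t] sep[OF \<open>s \<in> S\<close>, of t] by (cases "ev t = ev s") auto
  qed
  also have "\<dots> = c s * poly p (ev s) * x s (k s)"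
    using \<open>finite S\<close> \<open>s \<in> S\<close> by simp
  finally show ?thesis using ps nz \<open>s \<in> S\<close> by simp
qed

text \<open>Indexing by a set \<open>S\<close> instead of by eigenvalues admits repeated
  eigenvalues; \<open>sep\<close> certifies independence within an eigenspace. The eigenvectors are
  the columns of an invertible \<open>P\<close> with \<open>A * P = P * D\<close>.\<close>

lemma diagonalizable_by_eigenvectors:
  fixes A :: "'a :: field mat" and x :: "'s \<Rightarrow> nat \<Rightarrow> 'a"
  assumes A: "A \<in> carrier_mat N N" and S: "finite S" "card S = N"
    and eig: "\<And>s i. s \<in> S \<Longrightarrow> i < N \<Longrightarrow> (\<Sum>j<N. A $$ (i,j) * x s j) = ev s * x s i"
    and nz: "\<And>s. s \<in> S \<Longrightarrow> k s < N \<and> x s (k s) \<noteq> 0"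
    and sep: "\<And>s t. s \<in> S \<Longrightarrow> t \<in> S \<Longrightarrow> s \<noteq> t \<Longrightarrow> ev s = ev t \<Longrightarrow> x t (k s) = 0"
  shows "\<exists>D. similar_mat A D \<and> diagonal_mat D" (is ?diag)
    and "char_poly A = (\<Prod>s\<in>S. [:- ev s, 1:])" (is ?char)
proof -
  obtain h where h: "bij_betw h {0..<N} S"
    using ex_bij_betw_nat_finite[OF S(1)] S(2) by auto
  have hS: "h j \<in> S" if "j < N" for j using h that by (auto simp: bij_betw_def)
  define P where "P = mat N N (\<lambda>(i,j). x (h j) i)"
  define D where "D = mat N N (\<lambda>(i,j). if i = j then ev (h i) else 0)"
  have P: "P \<in> carrier_mat N N" and D: "D \<in> carrier_mat N N"
    by (auto simp: P_def D_def)
  have AP: "A * P = P * D"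
  proof (rule eq_matI)
    fix i j assume "i < dim_row (P * D)" "j < dim_col (P * D)"
    then have ij: "i < N" "j < N" using P D by auto
    have "(A * P) $$ (i,j) = (\<Sum>l<N. A $$ (i,l) * x (h j) l)"
      using A ij by (simp add: P_def scalar_prod_def atLeast0LessThan)
    also have "\<dots> = ev (h j) * x (h j) i" using eig hS ij by simp
    also have "\<dots> = (\<Sum>l<N. x (h l) i * (if l = j then ev (h l) else 0))"
      using ij by (simp add: if_distrib mult.commute cong: if_cong)
    also have "\<dots> = (P * D) $$ (i,j)"
      using ij by (simp add: P_def D_def scalar_prod_def atLeast0LessThan)
    finally show "(A * P) $$ (i,j) = (P * D) $$ (i,j)" .
  qed (use A P D in auto)
  have "det P \<noteq> 0"
  proof
    assume "det P = 0"
    then obtain v where v: "v \<in> carrier_vec N" "v \<noteq> 0\<^sub>v N" "P *\<^sub>v v = 0\<^sub>v N"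
      using det_0_iff_vec_prod_zero[OF P] by auto
    define c where "c s = v $ (the_inv_into {0..<N} h s)" for s
    have ch: "c (h j) = v $ j" if "j < N" for j
      using h that by (simp add: c_def the_inv_into_f_f bij_betw_def)
    have "(\<Sum>s\<in>S. c s * x s i) = 0" if i: "i < N" for i
    proof -
      have "(\<Sum>s\<in>S. c s * x s i) = (\<Sum>j\<in>{0..<N}. c (h j) * x (h j) i)"
        using sum.reindex_bij_betw[OF h, of "\<lambda>s. c s * x s i"] by simp
      also have "\<dots> = (P *\<^sub>v v) $ i"
        using i v(1) ch by (simp add: P_def scalar_prod_def mult.commute)
      finally show ?thesis using i by (simp add: v(3))
    qed
    then have "c s = 0" if "s \<in> S" for s
      using eigenvectors_independent[of S N A x ev k c s] S(1) eig nz sep that by blast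
    then have "v $ j = 0" if "j < N" for j using ch hS that by metis
    then show False using v(1,2) by (auto intro!: eq_vecI)
  qed
  then obtain Q where Q: "Q \<in> carrier_mat N N" "Q * P = 1\<^sub>m N" "P * Q = 1\<^sub>m N"
    using det_non_zero_imp_unit[OF P]
    by (auto simp: Units_def ring_mat_def)
  have "A = A * (P * Q)" using A Q(3) by simp
  also have "\<dots> = P * D * Q" using A P Q(1) by (simp flip: assoc_mult_mat AP)
  finally have sim: "similar_mat A D"
    using A P Q D by (intro similar_matI[of A D P Q N]) auto
  have "diagonal_mat D" by (auto simp: diagonal_mat_def D_def)
  with sim show ?diag by blast
  have "char_poly A = char_poly D" by (rule char_poly_similar[OF sim])
  also have "\<dots> = (\<Prod>a\<leftarrow>diag_mat D. [:- a, 1:])"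
    by (rule char_poly_upper_triangular[OF D]) (auto simp: upper_triangular_def D_def)
  also have "\<dots> = (\<Prod>j\<in>{0..<N}. [:- ev (h j), 1:])"
    by (simp add: diag_mat_def D_def prod.list_conv_set_nth)
  also have "\<dots> = (\<Prod>s\<in>S. [:- ev s, 1:])"
    using prod.reindex_bij_betw[OF h, of "\<lambda>s. [:- ev s, 1:]"] by simp
  finally show ?char .
qed

section \<open>Matrices of operators given by coordinate formulas\<close>

text \<open>Operators act on functions on all natural numbers, which keeps coordinate formulas free
  of carrier conditions. By the last clause the first \<open>N\<close> values of \<open>L x\<close>
  depend only on the first \<open>N\<close> values of \<open>x\<close>, so that an \<open>N\<close>
  by \<open>N\<close> matrix can represent \<open>L\<close>.\<close>

definition coordinate_linear :: "nat \<Rightarrow> ((nat \<Rightarrow> 'a) \<Rightarrow> nat \<Rightarrow> 'a :: comm_ring_1) \<Rightarrow> bool" where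
  "coordinate_linear N L \<longleftrightarrow>
     (\<forall>x y i. L (\<lambda>k. x k + y k) i = L x i + L y i) \<and>
     (\<forall>c x i. L (\<lambda>k. c * x k) i = c * L x i) \<and>
     (\<forall>x y i. i < N \<longrightarrow> (\<forall>k<N. x k = y k) \<longrightarrow> L x i = L y i)"

definition operator_mat :: "nat \<Rightarrow> ((nat \<Rightarrow> 'a) \<Rightarrow> nat \<Rightarrow> 'a :: comm_ring_1) \<Rightarrow> 'a mat" where
  "operator_mat N L = mat N N (\<lambda>(i,j). L (\<lambda>k. if k = j then 1 else 0) i)"

lemma operator_mat_carrier [simp]: "operator_mat N L \<in> carrier_mat N N"
  by (simp add: operator_mat_def)

lemma operator_mat_row_sum:
  fixes L :: "(nat \<Rightarrow> 'a) \<Rightarrow> nat \<Rightarrow> 'a :: comm_ring_1"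
  assumes L: "coordinate_linear N L" and i: "i < N"
  shows "(\<Sum>j<N. operator_mat N L $$ (i,j) * x j) = L x i"
proof -
  have add: "L (\<lambda>k. x k + y k) i = L x i + L y i"
    and scale: "L (\<lambda>k. c * x k) i = c * L x i"
    and local: "i < N \<Longrightarrow> (\<And>k. k < N \<Longrightarrow> x k = y k) \<Longrightarrow> L x i = L y i" for x y c i
    using L by (auto simp: coordinate_linear_def)
  have lin: "L (\<lambda>k. \<Sum>j\<in>J. x j * (if k = j then 1 else 0)) i
      = (\<Sum>j\<in>J. x j * L (\<lambda>k. if k = j then 1 else 0) i)" if "finite J" for J
    using that
  proof (induction J)
    case empty
    show ?case using scale[of 0 "\<lambda>_. 0" i] by simp
  next
    case (insert a J)
    then show ?case by (simp add: add scale)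
  qed
  \<comment> \<open>The combination of unit functions agrees with \<open>x\<close> only below
    \<open>N\<close>, hence the appeal to locality.\<close>
  have "L x i = L (\<lambda>k. \<Sum>j\<in>{..<N}. x j * (if k = j then 1 else 0)) i"
    by (rule local[OF i]) (simp add: if_distrib cong: if_cong)
  also have "\<dots> = (\<Sum>j<N. x j * L (\<lambda>k. if k = j then 1 else 0) i)"
    by (rule lin) simp
  also have "\<dots> = (\<Sum>j<N. operator_mat N L $$ (i,j) * x j)"
    using i by (simp add: operator_mat_def mult.commute)
  finally show ?thesis ..
qed

section \<open>Isometries of the hyperbolic lattice\<close>

lemma sum_pairs:
  fixes f :: "nat \<Rightarrow> 'a :: comm_monoid_add"
  shows "(\<Sum>k<2*n. f k) = (\<Sum>i<n. f (2*i) + f (2*i+1))"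
  by (induction n) (simp_all add: ac_simps)

lemma congruence_entry_gram_form:
  assumes "G \<in> carrier_mat N N" "P \<in> carrier_mat N N" "Q \<in> carrier_mat N N" "i < N" "j < N"
  shows "(transpose_mat P * G * Q) $$ (i,j) = gram_form G (col P i) (col Q j)"
proof -
  have "transpose_mat P * G * Q = transpose_mat P * (G * Q)"
    using assms by (intro assoc_mult_mat) auto
  also have "\<dots> $$ (i,j) = col P i \<bullet> col (G * Q) j"
    using assms by simp
  also have "col (G * Q) j = G *\<^sub>v col Q j"
    using assms by (intro col_mult2) auto
  finally show ?thesis by (simp only: gram_form_def)
qed

lemma mult_mat_unit_vec:
  "A \<in> carrier_mat m N \<Longrightarrow> i < N \<Longrightarrow> A *\<^sub>v unit_vec N i = (col A i :: 'a :: semiring_1 vec)"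
  by (rule eq_vecI) auto

section \<open>The lattice of n hyperbolic planes\<close>

text \<open>Coordinates \<open>2*i\<close> and \<open>2*i+1\<close> belong to the i-th hyperbolic
  pair. Interleaving the pairs turns orthogonal sums of such lattices into concatenation of
  coordinates.\<close>

definition hyperbolic_gram :: "nat \<Rightarrow> 'a :: comm_ring_1 mat" where
  "hyperbolic_gram n = mat (2*n) (2*n) (\<lambda>(i,j). if i div 2 = j div 2 \<and> i \<noteq> j then 1 else 0)"

lemma hyperbolic_gram_carrier [simp]: "hyperbolic_gram n \<in> carrier_mat (2*n) (2*n)"
  and hyperbolic_gram_dim [simp]: "dim_row (hyperbolic_gram n) = 2*n" "dim_col (hyperbolic_gram n) = 2*n"
  by (simp_all add: hyperbolic_gram_def)

lemma map_hyperbolic_gram: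
  "map_mat of_int (hyperbolic_gram n) = (hyperbolic_gram n :: 'a :: comm_ring_1 mat)"
  by (rule eq_matI) (auto simp: hyperbolic_gram_def)

lemma hyperbolic_gram_mult_vec:
  assumes "y \<in> carrier_vec (2*n)" "i < n"
  shows "(hyperbolic_gram n *\<^sub>v y) $ (2*i) = y $ (2*i+1)"
    and "(hyperbolic_gram n *\<^sub>v y) $ (2*i+1) = y $ (2*i)"
proof -
  have half: "i = j div 2 \<longleftrightarrow> j = 2*i \<or> j = 2*i+1" for j :: nat
    by linarith
  have e: "(2*i) div 2 = j div 2 \<and> 2*i \<noteq> j \<longleftrightarrow> j = 2*i+1" for j :: nat
    using half[of j] by auto
  have o: "(2*i+1) div 2 = j div 2 \<and> 2*i+1 \<noteq> j \<longleftrightarrow> j = 2*i" for j :: nat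
    using half[of j] by auto
  have "(hyperbolic_gram n *\<^sub>v y) $ (2*i)
      = (\<Sum>j<2*n. (if (2*i) div 2 = j div 2 \<and> 2*i \<noteq> j then 1 else 0) * y $ j)"
    using assms by (simp add: hyperbolic_gram_def scalar_prod_def atLeast0LessThan)
  also have "\<dots> = y $ (2*i+1)"
    unfolding e using assms by (simp add: if_distrib[of "\<lambda>c. c * _"] cong: if_cong)
  finally show "(hyperbolic_gram n *\<^sub>v y) $ (2*i) = y $ (2*i+1)" .
  have "(hyperbolic_gram n *\<^sub>v y) $ (2*i+1)
      = (\<Sum>j<2*n. (if (2*i+1) div 2 = j div 2 \<and> 2*i+1 \<noteq> j then 1 else 0) * y $ j)"
    using assms by (simp add: hyperbolic_gram_def scalar_prod_def atLeast0LessThan)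
  also have "\<dots> = y $ (2*i)"
    unfolding o using assms by (simp add: if_distrib[of "\<lambda>c. c * _"] cong: if_cong)
  finally show "(hyperbolic_gram n *\<^sub>v y) $ (2*i+1) = y $ (2*i)" .
qed

lemma hyperbolic_gram_mult_vec_carrier [simp]: "hyperbolic_gram n *\<^sub>v y \<in> carrier_vec (2*n)"
  by (rule carrier_vecI) simp

definition pair_form :: "nat \<Rightarrow> (nat \<Rightarrow> 'a) \<Rightarrow> (nat \<Rightarrow> 'a) \<Rightarrow> 'a :: comm_ring_1" where
  "pair_form n x y = (\<Sum>i<n. x (2*i) * y (2*i+1) + x (2*i+1) * y (2*i))"

lemma gram_form_hyperbolic:
  assumes "x \<in> carrier_vec (2*n)" "y \<in> carrier_vec (2*n)"
  shows "gram_form (hyperbolic_gram n) x y = pair_form n (($) x) (($) y)"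
proof -
  have "gram_form (hyperbolic_gram n) x y = (\<Sum>k<2*n. x $ k * (hyperbolic_gram n *\<^sub>v y) $ k)"
    by (simp add: gram_form_def scalar_prod_def atLeast0LessThan)
  also have "\<dots> = pair_form n (($) x) (($) y)"
    unfolding sum_pairs pair_form_def using assms
    by (intro sum.cong refl) (simp add: hyperbolic_gram_mult_vec del: One_nat_def index_mult_mat_vec)
  finally show ?thesis .
qed

lemma pair_form_commute: "pair_form n x y = pair_form n y x"
  unfolding pair_form_def by (intro sum.cong refl) (simp add: algebra_simps)

lemma pair_form_unit:
  assumes "i < n"
  shows "pair_form n x (\<lambda>k. if k = 2*i then 1 else 0) = x (2*i+1)"
    and "pair_form n x (\<lambda>k. if k = 2*i+1 then 1 else 0) = x (2*i)"
proof -
  have [simp]: "2*k = 2*j+1 \<longleftrightarrow> False" "2*j+1 = 2*k \<longleftrightarrow> False" for j k :: nat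
    by presburger+
  show "pair_form n x (\<lambda>k. if k = 2*i then 1 else 0) = x (2*i+1)"
    "pair_form n x (\<lambda>k. if k = 2*i+1 then 1 else 0) = x (2*i)"
    unfolding pair_form_def using assms
    by (simp_all add: if_distrib[of "\<lambda>c. _ * c"] del: One_nat_def cong: if_cong)
qed

lemma pair_form_unit_vec: "pair_form n x (($) (unit_vec (2*n) i)) = pair_form n x (\<lambda>k. if k = i then 1 else 0)"
  unfolding pair_form_def by (intro sum.cong refl) (auto simp: unit_vec_def)

lemma pair_form_cong:
  assumes "\<And>k. k < 2*n \<Longrightarrow> x k = x' k" "\<And>k. k < 2*n \<Longrightarrow> y k = y' k"
  shows "pair_form n x y = pair_form n x' y'"
  unfolding pair_form_def by (intro sum.cong refl) (simp add: assms)

lemma gram_form_unit: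
  assumes "x \<in> carrier_vec (2*n)" "i < n"
  shows "gram_form (hyperbolic_gram n) x (unit_vec (2*n) (2*i)) = x $ (2*i+1)"
    and "gram_form (hyperbolic_gram n) x (unit_vec (2*n) (2*i+1)) = x $ (2*i)"
  using assms by (simp_all add: gram_form_hyperbolic pair_form_unit_vec pair_form_unit del: One_nat_def)

lemma less_double_cases:
  assumes "k < 2*n"
  obtains i where "i < n" "k = 2*i" | i where "i < n" "k = 2*i+(1::nat)"
proof (cases "even k")
  case True
  then show ?thesis using that(1)[of "k div 2"] assms by auto
next
  case False
  then show ?thesis using that(2)[of "k div 2"] assms by (auto elim!: oddE)
qed

text \<open>Pairing with a unit vector reads off the partner coordinate. This gives nondegeneracy
  and forces dual vectors to be integral; the form is even because \<open>pair_form n x x\<close> is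
  a sum of doubled products.\<close>

lemma hyperbolic_even_unimodular: "even_unimodular (hyperbolic_gram n)"
proof -
  have "nondegenerate_form (hyperbolic_gram n)"
    unfolding nondegenerate_form_def hyperbolic_gram_dim
  proof (intro ballI impI)
    fix x :: "int vec"
    assume x: "x \<in> carrier_vec (2*n)"
      and "\<forall>y\<in>carrier_vec (2*n). gram_form (hyperbolic_gram n) x y = 0"
    then have "x $ (2*i) = 0" "x $ (2*i+1) = 0" if "i < n" for i
      using gram_form_unit[OF x that] that by (metis unit_vec_carrier)+
    then show "x = 0\<^sub>v (2*n)"
      using x by (intro eq_vecI) (auto elim!: less_double_cases)
  qed
  moreover have "even (gram_form (hyperbolic_gram n) x x)" if "x \<in> carrier_vec (2*n)" for x :: "int vec"
    using that by (simp add: gram_form_hyperbolic pair_form_def mult.commute dvd_sum flip: mult_2)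
  ultimately have ez: "even_zlattice (hyperbolic_gram n)"
    unfolding even_zlattice_def zlattice_def
    by (auto simp: gram_form_hyperbolic intro: pair_form_commute)
  have "dual_lattice (hyperbolic_gram n) = integral_vecs (2*n)"
  proof (intro subset_antisym subsetI)
    fix x assume "x \<in> dual_lattice (hyperbolic_gram n)"
    then have x: "x \<in> carrier_vec (2*n)"
      and int: "\<And>y. y \<in> integral_vecs (2*n) \<Longrightarrow> gram_form (hyperbolic_gram n) x y \<in> \<int>"
      by (auto simp: dual_lattice_def map_hyperbolic_gram)
    have "unit_vec (2*n) k \<in> integral_vecs (2*n)" for k
      unfolding integral_vecs_def by (rule image_eqI[of _ _ "unit_vec (2*n) k"])
        (auto intro!: eq_vecI simp: unit_vec_def)
    then have "x $ (2*i) \<in> \<int>" "x $ (2*i+1) \<in> \<int>" if "i < n" for i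
      using gram_form_unit[OF x that] int by metis+
    then have xk: "x $ k \<in> \<int>" if "k < 2*n" for k
      using that by (auto elim!: less_double_cases)
    have "x = map_vec of_int (vec (2*n) (\<lambda>k. \<lfloor>x $ k\<rfloor>))"
      using x xk by (intro eq_vecI) (auto elim!: Ints_cases)
    then show "x \<in> integral_vecs (2*n)"
      unfolding integral_vecs_def by (metis imageI vec_carrier)
  next
    fix x assume "x \<in> integral_vecs (2*n)"
    then obtain x' :: "int vec" where x': "x' \<in> carrier_vec (2*n)" "x = map_vec of_int x'"
      by (auto simp: integral_vecs_def)
    have "gram_form (hyperbolic_gram n) x y \<in> \<int>" if y: "y \<in> integral_vecs (2*n)" for y
    proof -
      obtain y' :: "int vec" where y': "y' \<in> carrier_vec (2*n)" "y = map_vec of_int y'"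
        using y by (auto simp: integral_vecs_def)
      show ?thesis
        using x' y' by (auto simp: gram_form_hyperbolic pair_form_def intro!: Ints_sum Ints_add Ints_mult)
    qed
    then show "x \<in> dual_lattice (hyperbolic_gram n)"
      using x' by (auto simp: dual_lattice_def map_hyperbolic_gram)
  qed
  with ez show ?thesis by (simp add: even_unimodular_def)
qed

lemma hyperbolic_signature: "has_signature (hyperbolic_gram n) n n"
proof -
  define s where "s i = (if even i then 1 else -1 :: real)" for i :: nat
  \<comment> \<open>Column \<open>2*l\<close> is e + f and column \<open>2*l+1\<close> is e - f for
    the l-th hyperbolic pair (e, f); their norms are 2 and -2.\<close>
  define P where "P = mat (2*n) (2*n)
    (\<lambda>(i,j). if i div 2 = j div 2 then (if odd i then s j else 1) else 0)"
  define D where "D = transpose_mat P * hyperbolic_gram n * P"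
  have P: "P \<in> carrier_mat (2*n) (2*n)" and dD: "D \<in> carrier_mat (2*n) (2*n)"
    by (auto simp: P_def D_def)
  have col: "col P i $ k = (if k div 2 = i div 2 then (if odd k then s i else 1) else 0)"
    if "i < 2*n" "k < 2*n" for i k
    using that by (auto simp: P_def)
  have D: "D $$ (i,j) = (if i = j then 2 * s i else 0)" if ij: "i < 2*n" "j < 2*n" for i j
  proof -
    have l: "i div 2 < n" using ij by auto
    have "D $$ (i,j) = pair_form n (($) (col P i)) (($) (col P j))"
      unfolding D_def using P ij
      by (subst congruence_entry_gram_form[of _ "2*n"]) (auto intro!: gram_form_hyperbolic)
    also have "\<dots> = (\<Sum>l<n. if l = i div 2 then (if i div 2 = j div 2 then s i + s j else 0) else 0)"
      unfolding pair_form_def using ij by (intro sum.cong refl) (auto simp: col)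
    also have "\<dots> = (if i div 2 = j div 2 then s i + s j else 0)"
      using l by simp
    also have "\<dots> = (if i = j then 2 * s i else 0)"
    proof (cases "i div 2 = j div 2 \<and> i \<noteq> j")
      case True
      then have "even i \<noteq> even j" by presburger
      then show ?thesis using True by (auto simp: s_def)
    qed auto
    finally show ?thesis .
  qed
  \<comment> \<open>The block with rows (1, 1) and (1, -1) squares to twice the identity, so
    \<open>P\<close> is its own inverse up to the factor 1/2.\<close>
  have PP: "P * ((1/2) \<cdot>\<^sub>m P) = 1\<^sub>m (2*n)" "((1/2) \<cdot>\<^sub>m P) * P = 1\<^sub>m (2*n)"
  proof -
    have "(P * P) $$ (i,j) = (if i = j then 2 else 0)" if ij: "i < 2*n" "j < 2*n" for i j
    proof -
      have l: "i div 2 < n" using ij by auto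
      have "(P * P) $$ (i,j) = (\<Sum>k<2*n. P $$ (i,k) * P $$ (k,j))"
        using P ij by (simp add: scalar_prod_def atLeast0LessThan)
      also have "\<dots> = (\<Sum>l<n. if l = i div 2 then (if i div 2 = j div 2 then 1 + s i * s j else 0) else 0)"
        unfolding sum_pairs using ij by (intro sum.cong refl) (auto simp: P_def s_def)
      also have "\<dots> = (if i div 2 = j div 2 then 1 + s i * s j else 0)"
        using l by simp
      also have "\<dots> = (if i = j then 2 else 0)"
      proof (cases "i div 2 = j div 2 \<and> i \<noteq> j")
        case True
        then have "even i \<noteq> even j" by presburger
        then show ?thesis using True by (auto simp: s_def)
      qed (auto simp: s_def)
      finally show ?thesis .
    qed
    then have "(1/2) \<cdot>\<^sub>m (P * P) = 1\<^sub>m (2*n)"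
      using P by (intro eq_matI) auto
    then show "P * ((1/2) \<cdot>\<^sub>m P) = 1\<^sub>m (2*n)" "((1/2) \<cdot>\<^sub>m P) * P = 1\<^sub>m (2*n)"
      using mult_smult_distrib[OF P P] mult_smult_assoc_mat[OF P P] by auto
  qed
  have "invertible_mat P"
    unfolding invertible_mat_def inverts_mat_def
    using P PP by (auto intro!: exI[of _ "(1/2) \<cdot>\<^sub>m P"])
  moreover have "diagonal_mat D"
    using dD D by (auto simp: diagonal_mat_def)
  moreover have "{i. i < 2*n \<and> D $$ (i,i) > 0} = (\<lambda>i. 2*i) ` {..<n}"
  proof -
    have "{i. i < 2*n \<and> D $$ (i,i) > 0} = {i. i < 2*n \<and> even i}"
      using D by (auto simp: s_def split: if_splits)
    also have "\<dots> = (\<lambda>i. 2*i) ` {..<n}"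
      by (auto simp: image_iff elim!: less_double_cases)
    finally show ?thesis .
  qed
  moreover have "{i. i < 2*n \<and> D $$ (i,i) < 0} = (\<lambda>i. 2*i+1) ` {..<n}"
  proof -
    have "{i. i < 2*n \<and> D $$ (i,i) < 0} = {i. i < 2*n \<and> odd i}"
      using D by (auto simp: s_def split: if_splits)
    also have "\<dots> = (\<lambda>i. 2*i+1) ` {..<n}"
      by (auto simp: image_iff elim!: less_double_cases)
    finally show ?thesis .
  qed
  moreover have "card ((\<lambda>i::nat. 2*i) ` {..<n}) = n" "card ((\<lambda>i::nat. 2*i+1) ` {..<n}) = n"
    by (simp_all add: card_image inj_on_def)
  ultimately show ?thesis
    unfolding has_signature_def hyperbolic_gram_dim map_hyperbolic_gram
    using P D_def by (intro bexI[of _ P] exI[of _ D]) auto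
qed

section \<open>Isometries and orthogonal sums\<close>

definition hyperbolic_isometry :: "nat \<Rightarrow> int mat \<Rightarrow> bool" where
  "hyperbolic_isometry n A \<longleftrightarrow> A \<in> carrier_mat (2*n) (2*n) \<and>
     (\<forall>x\<in>carrier_vec (2*n). \<forall>y\<in>carrier_vec (2*n).
        gram_form (hyperbolic_gram n) (A *\<^sub>v x) (A *\<^sub>v y) = gram_form (hyperbolic_gram n) x y)"

text \<open>Since the Gram matrix has unit determinant, preserving the form forces
  \<open>det A * det A = 1\<close>. Then \<open>det A\<close> times the adjugate is an integral
  inverse.\<close>

lemma hyperbolic_isometry_imp_lattice_isometry:
  assumes "hyperbolic_isometry n A"
  shows "lattice_isometry (hyperbolic_gram n) A"
proof -
  let ?G = "hyperbolic_gram n :: int mat" and ?N = "2*n"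
  have A: "A \<in> carrier_mat ?N ?N"
    and iso: "\<And>x y. x \<in> carrier_vec ?N \<Longrightarrow> y \<in> carrier_vec ?N \<Longrightarrow>
        gram_form ?G (A *\<^sub>v x) (A *\<^sub>v y) = gram_form ?G x y"
    using assms by (auto simp: hyperbolic_isometry_def)
  have AGA: "transpose_mat A * ?G * A = ?G"
  proof (rule eq_matI)
    fix i j assume "i < dim_row ?G" "j < dim_col ?G"
    then have ij: "i < ?N" "j < ?N" by auto
    have "(transpose_mat A * ?G * A) $$ (i,j) = gram_form ?G (col A i) (col A j)"
      using A ij by (intro congruence_entry_gram_form) auto
    also have "\<dots> = gram_form ?G (unit_vec ?N i) (unit_vec ?N j)"
      using iso[of "unit_vec ?N i" "unit_vec ?N j"] A ij by (simp add: mult_mat_unit_vec[of _ ?N ?N])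
    also have "\<dots> = ?G $$ (i,j)"
      using ij by (simp add: gram_form_def mult_mat_unit_vec[of _ ?N ?N])
    finally show "(transpose_mat A * ?G * A) $$ (i,j) = ?G $$ (i,j)" .
  qed (use A in auto)
  have GG: "?G * ?G = 1\<^sub>m ?N"
  proof (rule eq_matI)
    fix i j assume "i < dim_row (1\<^sub>m ?N :: int mat)" "j < dim_col (1\<^sub>m ?N :: int mat)"
    then have ij: "i < ?N" "j < ?N" by auto
    have "(?G * ?G) $$ (i,j) = (?G *\<^sub>v (?G *\<^sub>v unit_vec ?N j)) $ i"
      using ij by (simp add: mult_mat_unit_vec[of _ ?N ?N] flip: col_mult2[of _ ?N ?N _ ?N])
    also have "\<dots> = (1\<^sub>m ?N :: int mat) $$ (i,j)"
      using ij by (auto elim!: less_double_cases[of i] simp: hyperbolic_gram_mult_vec simp del: One_nat_def index_mult_mat_vec)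
    finally show "(?G * ?G) $$ (i,j) = (1\<^sub>m ?N :: int mat) $$ (i,j)" .
  qed auto
  have "det (transpose_mat A * ?G * A) = det A * det ?G * det A"
    using A by (simp add: det_mult[of _ ?N] det_transpose)
  moreover have "det ?G * det ?G = 1"
    using GG det_mult[of ?G ?N ?G] by simp
  ultimately have dd: "det A * det A = 1"
    unfolding AGA by (metis mult.assoc mult.commute mult.right_neutral)
  define B where "B = det A \<cdot>\<^sub>m adj_mat A"
  have adj: "adj_mat A \<in> carrier_mat ?N ?N" "A * adj_mat A = det A \<cdot>\<^sub>m 1\<^sub>m ?N"
    "adj_mat A * A = det A \<cdot>\<^sub>m 1\<^sub>m ?N"
    using adj_mat[OF A] by auto
  have B: "B \<in> carrier_mat ?N ?N" using adj by (simp add: B_def)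
  have dd1: "det A \<cdot>\<^sub>m (det A \<cdot>\<^sub>m 1\<^sub>m ?N) = 1\<^sub>m ?N"
    using dd by (intro eq_matI) auto
  have AB: "A * B = 1\<^sub>m ?N" "B * A = 1\<^sub>m ?N"
    unfolding B_def using mult_smult_distrib[OF A adj(1)] mult_smult_assoc_mat[OF adj(1) A] adj dd1 by auto
  have "bij_betw (\<lambda>x. A *\<^sub>v x) (carrier_vec ?N) (carrier_vec ?N)"
  proof (rule bij_betw_byWitness[of _ "\<lambda>x. B *\<^sub>v x"])
    show "\<forall>a\<in>carrier_vec ?N. B *\<^sub>v (A *\<^sub>v a) = a" "\<forall>a\<in>carrier_vec ?N. A *\<^sub>v (B *\<^sub>v a) = a"
      using A B AB by (simp_all flip: assoc_mult_mat_vec)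
  qed (use A B in auto)
  then show ?thesis
    using A iso by (simp add: lattice_isometry_def)
qed

definition hyperbolic_realizes :: "nat \<Rightarrow> int poly \<Rightarrow> bool" where
  "hyperbolic_realizes n F \<longleftrightarrow>
     (\<exists>A. hyperbolic_isometry n A \<and> semisimple_endo A \<and> char_poly A = F)"

lemma pair_form_add:
  "pair_form (n + m) x y = pair_form n x y + pair_form m (\<lambda>k. x (2*n+k)) (\<lambda>k. y (2*n+k))"
proof -
  have "(\<Sum>i<n+m. f i) = (\<Sum>i<n. f i) + (\<Sum>i<m. f (n+i))" for f :: "nat \<Rightarrow> 'a"
    by (induction m) (simp_all add: ac_simps)
  then show ?thesis by (simp add: pair_form_def algebra_simps)
qed

lemma char_poly_block_diagonal:
  fixes A B :: "'a :: idom mat"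
  assumes A: "A \<in> carrier_mat n n" and B: "B \<in> carrier_mat m m"
  shows "char_poly (four_block_mat A (0\<^sub>m n m) (0\<^sub>m m n) B) = char_poly A * char_poly B"
proof -
  have "char_poly_matrix (four_block_mat A (0\<^sub>m n m) (0\<^sub>m m n) B)
      = four_block_mat (char_poly_matrix A) (0\<^sub>m n m) (0\<^sub>m m n) (char_poly_matrix B)"
    using A B by (intro eq_matI) (auto simp: char_poly_matrix_def)
  then show ?thesis
    unfolding char_poly_def using A B
    by (simp add: det_four_block_mat_lower_left_zero[of _ n _ m])
qed

lemma hyperbolic_realizes_mult:
  assumes "hyperbolic_realizes n F" "hyperbolic_realizes m F'"
  shows "hyperbolic_realizes (n + m) (F * F')"
proof -
  obtain A B where iA: "hyperbolic_isometry n A" and sA: "semisimple_endo A" and cA: "char_poly A = F"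
    and iB: "hyperbolic_isometry m B" and sB: "semisimple_endo B" and cB: "char_poly B = F'"
    using assms by (auto simp: hyperbolic_realizes_def)
  have A: "A \<in> carrier_mat (2*n) (2*n)" and B: "B \<in> carrier_mat (2*m) (2*m)"
    using iA iB by (auto simp: hyperbolic_isometry_def)
  let ?Z1 = "0\<^sub>m (2*n) (2*m) :: int mat" and ?Z2 = "0\<^sub>m (2*m) (2*n) :: int mat"
  define M where "M = four_block_mat A ?Z1 ?Z2 B"
  have M: "M \<in> carrier_mat (2*(n+m)) (2*(n+m))"
    unfolding M_def distrib_left by (rule four_block_carrier_mat[OF A B])
  have form: "gram_form (hyperbolic_gram (n+m)) (a @\<^sub>v b) (c @\<^sub>v d)
      = gram_form (hyperbolic_gram n) a c + gram_form (hyperbolic_gram m) b d"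
    if "a \<in> carrier_vec (2*n)" "c \<in> carrier_vec (2*n)" "b \<in> carrier_vec (2*m)" "d \<in> carrier_vec (2*m)"
    for a b c d :: "int vec"
  proof -
    have "a @\<^sub>v b \<in> carrier_vec (2*(n+m))" "c @\<^sub>v d \<in> carrier_vec (2*(n+m))"
      using that by auto
    then have "gram_form (hyperbolic_gram (n+m)) (a @\<^sub>v b) (c @\<^sub>v d)
      = pair_form n (($) (a @\<^sub>v b)) (($) (c @\<^sub>v d))
        + pair_form m (\<lambda>k. (a @\<^sub>v b) $ (2*n+k)) (\<lambda>k. (c @\<^sub>v d) $ (2*n+k))"
      by (simp add: gram_form_hyperbolic pair_form_add)
    also have "pair_form n (($) (a @\<^sub>v b)) (($) (c @\<^sub>v d)) = pair_form n (($) a) (($) c)"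
      using that by (intro pair_form_cong) auto
    also have "pair_form m (\<lambda>k. (a @\<^sub>v b) $ (2*n+k)) (\<lambda>k. (c @\<^sub>v d) $ (2*n+k))
        = pair_form m (($) b) (($) d)"
      using that by (intro pair_form_cong) auto
    finally show ?thesis using that by (simp add: gram_form_hyperbolic)
  qed
  have "hyperbolic_isometry (n+m) M"
    unfolding hyperbolic_isometry_def
  proof (intro conjI ballI M)
    fix x y :: "int vec" assume "x \<in> carrier_vec (2*(n+m))" "y \<in> carrier_vec (2*(n+m))"
    then have xy: "x \<in> carrier_vec (2*n + 2*m)" "y \<in> carrier_vec (2*n + 2*m)"
      by (simp_all add: algebra_simps)
    obtain a b where x: "x = a @\<^sub>v b" "a \<in> carrier_vec (2*n)" "b \<in> carrier_vec (2*m)"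
      using vec_first_last_append[OF xy(1)] by (metis vec_first_carrier vec_last_carrier)
    obtain c d where y: "y = c @\<^sub>v d" "c \<in> carrier_vec (2*n)" "d \<in> carrier_vec (2*m)"
      using vec_first_last_append[OF xy(2)] by (metis vec_first_carrier vec_last_carrier)
    have Mx: "M *\<^sub>v (u @\<^sub>v v) = (A *\<^sub>v u) @\<^sub>v (B *\<^sub>v v)"
      if "u \<in> carrier_vec (2*n)" "v \<in> carrier_vec (2*m)" for u v
    proof -
      have "M *\<^sub>v (u @\<^sub>v v) = (A *\<^sub>v u + ?Z1 *\<^sub>v v) @\<^sub>v (?Z2 *\<^sub>v u + B *\<^sub>v v)"
        unfolding M_def using A B that by (intro four_block_mat_mult_vec) auto
      moreover have "?Z1 *\<^sub>v v = 0\<^sub>v (2*n)" "?Z2 *\<^sub>v u = 0\<^sub>v (2*m)"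
        using that by auto
      moreover have "A *\<^sub>v u \<in> carrier_vec (2*n)" "B *\<^sub>v v \<in> carrier_vec (2*m)"
        using A B that by auto
      ultimately show ?thesis by simp
    qed
    have car: "A *\<^sub>v a \<in> carrier_vec (2*n)" "A *\<^sub>v c \<in> carrier_vec (2*n)"
      "B *\<^sub>v b \<in> carrier_vec (2*m)" "B *\<^sub>v d \<in> carrier_vec (2*m)"
      using A B x y by auto
    show "gram_form (hyperbolic_gram (n+m)) (M *\<^sub>v x) (M *\<^sub>v y)
        = gram_form (hyperbolic_gram (n+m)) x y"
      unfolding x(1) y(1) using x(2,3) y(2,3) car iA iB
      by (simp add: Mx form hyperbolic_isometry_def)
  qed
  moreover have "char_poly M = F * F'"
    unfolding M_def using char_poly_block_diagonal[OF A B] cA cB by simp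
  moreover have "semisimple_endo M"
  proof -
    obtain D1 D2 :: "complex mat" where D: "similar_mat (map_mat of_int A) D1" "diagonal_mat D1"
      "similar_mat (map_mat of_int B) D2" "diagonal_mat D2"
      using sA sB by (auto simp: semisimple_endo_def)
    have D': "D1 \<in> carrier_mat (2*n) (2*n)" "D2 \<in> carrier_mat (2*m) (2*m)"
      using similar_matD[OF D(1)] similar_matD[OF D(3)] A B by auto
    have "map_mat complex_of_int M = four_block_mat (map_mat of_int A) (0\<^sub>m (2*n) (2*m)) (0\<^sub>m (2*m) (2*n)) (map_mat of_int B)"
      unfolding M_def using A B by (intro eq_matI) auto
    moreover have "similar_mat (four_block_mat (map_mat complex_of_int A) (0\<^sub>m (2*n) (2*m)) (0\<^sub>m (2*m) (2*n)) (map_mat of_int B))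
        (four_block_mat D1 (0\<^sub>m (2*n) (2*m)) (0\<^sub>m (2*m) (2*n)) D2)"
      using A B D by (intro similar_mat_four_block_0_0) auto
    moreover have "diagonal_mat (four_block_mat D1 (0\<^sub>m (2*n) (2*m)) (0\<^sub>m (2*m) (2*n)) D2)"
      using D D' by (auto simp: diagonal_mat_def)
    ultimately show ?thesis by (auto simp: semisimple_endo_def)
  qed
  ultimately show ?thesis by (auto simp: hyperbolic_realizes_def)
qed

text \<open>Common interface of the explicit constructions. \<open>L\<close> and \<open>LC\<close>
  are one formula over the integers and over the complex numbers, linked by \<open>compat\<close>.
  Eigenvectors of \<open>LC\<close> give semisimplicity and the complex characteristic polynomial,
  which determines the integral one.\<close>

lemma hyperbolic_realizes_operator:
  fixes L :: "(nat \<Rightarrow> int) \<Rightarrow> nat \<Rightarrow> int" and LC :: "(nat \<Rightarrow> complex) \<Rightarrow> nat \<Rightarrow> complex"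
  assumes L: "coordinate_linear (2*n) L" and LC: "coordinate_linear (2*n) LC"
    and compat: "\<And>x i. LC (\<lambda>k. of_int (x k)) i = of_int (L x i)"
    and iso: "\<And>x y. pair_form n (L x) (L y) = pair_form n x y"
    and S: "finite S" "card S = 2*n"
    and eig: "\<And>s i. s \<in> S \<Longrightarrow> i < 2*n \<Longrightarrow> LC (v s) i = ev s * v s i"
    and nz: "\<And>s. s \<in> S \<Longrightarrow> k s < 2*n \<and> v s (k s) \<noteq> 0"
    and sep: "\<And>s t. s \<in> S \<Longrightarrow> t \<in> S \<Longrightarrow> s \<noteq> t \<Longrightarrow> ev s = ev t \<Longrightarrow> v t (k s) = 0"
    and F: "map_poly of_int F = (\<Prod>s\<in>S. [:- ev s, 1:])"
  shows "hyperbolic_realizes n F"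
proof -
  let ?A = "operator_mat (2*n) L"
  have map: "map_mat of_int ?A = operator_mat (2*n) LC"
    by (rule eq_matI) (auto simp: operator_mat_def compat[symmetric] if_distrib[of of_int] cong: if_cong)
  have Ax: "(?A *\<^sub>v x) $ i = L (($) x) i" if "x \<in> carrier_vec (2*n)" "i < 2*n" for x i
  proof -
    have "(?A *\<^sub>v x) $ i = (\<Sum>j<2*n. ?A $$ (i,j) * x $ j)"
      using that by (simp add: operator_mat_def scalar_prod_def atLeast0LessThan)
    then show ?thesis using operator_mat_row_sum[OF L] that by simp
  qed
  have "gram_form (hyperbolic_gram n) (?A *\<^sub>v x) (?A *\<^sub>v y) = gram_form (hyperbolic_gram n) x y"
    if xy: "x \<in> carrier_vec (2*n)" "y \<in> carrier_vec (2*n)" for x y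
  proof -
    have "?A *\<^sub>v x \<in> carrier_vec (2*n)" "?A *\<^sub>v y \<in> carrier_vec (2*n)"
      using mult_mat_vec_carrier[OF operator_mat_carrier] xy by auto
    then have "gram_form (hyperbolic_gram n) (?A *\<^sub>v x) (?A *\<^sub>v y)
        = pair_form n (($) (?A *\<^sub>v x)) (($) (?A *\<^sub>v y))"
      by (rule gram_form_hyperbolic)
    also have "\<dots> = pair_form n (L (($) x)) (L (($) y))"
      using Ax xy by (intro pair_form_cong) auto
    finally show ?thesis using xy by (simp add: iso gram_form_hyperbolic)
  qed
  then have "hyperbolic_isometry n ?A" by (simp add: hyperbolic_isometry_def)
  moreover
  have e: "(\<Sum>j<2*n. operator_mat (2*n) LC $$ (i,j) * v s j) = ev s * v s i"
    if "s \<in> S" "i < 2*n" for s i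
    using operator_mat_row_sum[OF LC that(2)] eig[OF that] by simp
  have D: "\<exists>D. similar_mat (operator_mat (2*n) LC) D \<and> diagonal_mat D"
    "char_poly (operator_mat (2*n) LC) = (\<Prod>s\<in>S. [:- ev s, 1:])"
    by (rule diagonalizable_by_eigenvectors[of _ "2*n" S v ev k]; use S e nz sep operator_mat_carrier in blast)+
  have "semisimple_endo ?A"
    using D(1) by (simp add: semisimple_endo_def map)
  moreover have "map_poly complex_of_int (char_poly ?A) = map_poly of_int F"
    using D(2) by (simp add: F of_int_hom.char_poly_hom[OF operator_mat_carrier, symmetric] map)
  then have "char_poly ?A = F"
    by simp
  ultimately show ?thesis by (auto simp: hyperbolic_realizes_def)
qed

lemma hyperbolic_realizes_1: "hyperbolic_realizes 0 1"
proof -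
  have A: "1\<^sub>m 0 \<in> carrier_mat 0 (0::nat)" by simp
  have "semisimple_endo (1\<^sub>m 0)"
    unfolding semisimple_endo_def
    by (intro exI[of _ "map_mat of_int (1\<^sub>m 0)"] conjI similar_mat_refl[of _ 0]) (auto simp: diagonal_mat_def)
  moreover have "hyperbolic_isometry 0 (1\<^sub>m 0)"
    by (simp add: hyperbolic_isometry_def)
  moreover have "char_poly (1\<^sub>m 0 :: int mat) = 1"
    by (simp add: char_poly_def char_poly_matrix_def)
  ultimately show ?thesis by (auto simp: hyperbolic_realizes_def)
qed

lemma hyperbolic_realizes_swap: "hyperbolic_realizes 1 [:-1, 0, 1:]"
proof -
  let ?L = "\<lambda>(x :: nat \<Rightarrow> int) i :: nat. if i = 0 then x 1 else x 0"
  let ?LC = "\<lambda>(x :: nat \<Rightarrow> complex) i :: nat. if i = 0 then x 1 else x 0"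
  show ?thesis
  proof (rule hyperbolic_realizes_operator[of 1 ?L ?LC "{1,-1}" "\<lambda>s i. if i = 0 then 1 else s" "\<lambda>s. s" "\<lambda>_. 0"])
    show "coordinate_linear (2*1) ?L" "coordinate_linear (2*1) ?LC"
      by (auto simp: coordinate_linear_def)
    show "card {1,- 1::complex} = 2 * 1"
      by (simp add: card_insert_if complex_eq_iff)
    have "(1::complex) \<noteq> -1" by (simp add: complex_eq_iff)
    then show "map_poly of_int [:-1, 0, 1:] = (\<Prod>s\<in>{1,- 1::complex}. [:- s, 1:])"
      by (simp add: map_poly_pCons)
  qed (auto simp: pair_form_def algebra_simps)
qed

section \<open>Palindromic integer polynomials\<close>

lemma map_poly_mult_of_int:
  "map_poly complex_of_int (p * q) = map_poly of_int p * map_poly of_int q"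
  by (rule of_int_poly_hom.hom_mult)

text \<open>Gauss' lemma is avoided: a nonzero integer polynomial of least degree vanishing at
  \<open>z\<close> divides a nonzero integer multiple of every other one.\<close>

lemma prime_elem_dvd_if_common_root:
  fixes f g :: "int poly" and z :: complex
  assumes f: "prime_elem f" and fz: "poly (map_poly of_int f) z = 0" and gz: "poly (map_poly of_int g) z = 0"
  shows "f dvd g"
proof -
  define I where "I = {h :: int poly. h \<noteq> 0 \<and> poly (map_poly of_int h) z = 0}"
  have "f \<in> I" using f fz by (auto simp: I_def)
  \<comment> \<open>\<open>h\<close> stands in for the minimal polynomial of \<open>z\<close>:
    pseudo-division by it leaves no remainder on polynomials vanishing at \<open>z\<close>.\<close>
  then obtain h where h: "h \<in> I" and min: "\<And>g. g \<in> I \<Longrightarrow> degree h \<le> degree g"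
    using ex_has_least_nat[of "\<lambda>h. h \<in> I" f degree] by blast
  have h0: "h \<noteq> 0" "poly (map_poly of_int h) z = 0" using h by (auto simp: I_def)
  have nonconst: "p = 0" if "degree p = 0" "poly (map_poly of_int p) z = 0" for p :: "int poly"
    using that by (auto elim!: degree_eq_zeroE simp: of_int_hom.map_poly_pCons_hom)
  have div: "\<exists>c q. c \<noteq> 0 \<and> Polynomial.smult c g = h * q"
    if "poly (map_poly of_int g) z = 0" for g :: "int poly"
  proof -
    obtain a q where a: "a \<noteq> 0" "Polynomial.smult a g = h * q + pseudo_mod g h"
      using pseudo_mod(1)[OF h0(1), of g] by blast
    have "pseudo_mod g h = Polynomial.smult a g - h * q" using a(2) by simp
    then have "map_poly complex_of_int (pseudo_mod g h)
        = Polynomial.smult (of_int a) (map_poly of_int g) - map_poly of_int h * map_poly of_int q"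
      by (simp add: of_int_poly_hom.hom_minus of_int_poly_hom.hom_mult of_int_hom.map_poly_hom_smult)
    then have "poly (map_poly of_int (pseudo_mod g h)) z = 0"
      using that h0 by simp
    then have "pseudo_mod g h = 0"
      using min[of "pseudo_mod g h"] pseudo_mod(2)[OF h0(1), of g] by (fastforce simp: I_def)
    then show ?thesis using a by auto
  qed
  obtain c q where c: "c \<noteq> 0" "Polynomial.smult c f = h * q" using div[OF fz] by blast
  have "f dvd h * q" using c(2) by (metis dvd_refl dvd_smult)
  then have "f dvd h \<or> f dvd q" using f prime_elem_dvd_multD by blast
  then have fh: "f dvd h"
  proof
    \<comment> \<open>Cancelling \<open>f\<close> makes \<open>h\<close> divide a nonzero constant,
      so \<open>h\<close> is constant; this contradicts that it is nonzero and vanishes at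
      \<open>z\<close>.\<close>
    assume "f dvd q"
    then obtain q' where "q = f * q'" by blast
    with c(2) have "f * [:c:] = f * (h * q')" by (simp add: ac_simps)
    then have hq: "[:c:] = h * q'"
      unfolding mult_cancel_left using f by (auto simp: prime_elem_def)
    then have "q' \<noteq> 0" using c(1) by auto
    then have "degree h = 0" using arg_cong[OF hq, of degree] h0(1) by (simp add: degree_mult_eq)
    then show ?thesis using nonconst h0 by blast
  qed
  obtain c' q' where c': "c' \<noteq> 0" "Polynomial.smult c' g = h * q'" using div[OF gz] by blast
  have "f dvd [:c':] * g" using fh c'(2) by simp
  then have "f dvd [:c':] \<or> f dvd g" using f prime_elem_dvd_multD by blast
  moreover have "\<not> f dvd [:c':]"
  proof
    assume "f dvd [:c':]"
    then have "degree f = 0" using c'(1) by (metis degree_pCons_0 dvd_imp_degree_le le_zero_eq pCons_eq_0_iff)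
    then show False using nonconst[OF _ fz] f by auto
  qed
  ultimately show ?thesis by blast
qed

section \<open>Prime factors through a given complex root\<close>

lemma exists_prime_factor_with_root:
  fixes p :: "int poly" and z :: complex
  assumes "p \<noteq> 0" "poly (map_poly of_int p) z = 0"
  shows "\<exists>f. prime_elem f \<and> f dvd p \<and> poly (map_poly of_int f) z = 0"
  using assms
proof (induction p rule: prime_divisors_induct)
  case (unit x)
  then have "degree x = 0" by (simp add: is_unit_iff_degree poly_dvd_1)
  then show ?case using unit by (auto elim!: degree_eq_zeroE)
next
  case (factor p x)
  then have "poly (map_poly of_int p) z = 0 \<or> poly (map_poly of_int x) z = 0"
    by (simp add: map_poly_mult_of_int)
  then show ?case
  proof
    assume "poly (map_poly of_int p) z = 0"
    then show ?thesis using factor.hyps by (intro exI[of _ p]) auto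
  next
    assume "poly (map_poly of_int x) z = 0"
    then show ?thesis using factor by (auto intro: dvd_mult)
  qed
qed simp

text \<open>A factor of a monic integer polynomial has leading coefficient 1 or -1, and a change of
  sign preserves primality.\<close>

lemma exists_monic_prime_factor_with_root:
  fixes p :: "int poly" and z :: complex
  assumes "lead_coeff p = 1" "poly (map_poly of_int p) z = 0"
  obtains f where "prime_elem f" "f dvd p" "poly (map_poly of_int f) z = 0" "lead_coeff f = 1" "degree f > 0"
proof -
  have "p \<noteq> 0" using assms(1) by auto
  then obtain f where f: "prime_elem f" "f dvd p" "poly (map_poly of_int f) z = 0"
    using exists_prime_factor_with_root assms(2) by blast
  then obtain g where "p = f * g" by blast
  then have "lead_coeff f * lead_coeff g = 1" using assms(1) by (simp add: lead_coeff_mult)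
  then have "lead_coeff f = 1 \<or> lead_coeff f = -1" by (simp add: zmult_eq_1_iff) blast
  then obtain f' where f': "f' = f \<or> f' = - f" "lead_coeff f' = 1" by fastforce
  have "prime_elem f'" using f(1) f'(1) unfolding prime_elem_def
    by (metis minus_dvd_iff neg_equal_0_iff_equal)
  moreover have "f' dvd p" using f(2) f'(1) by auto
  moreover have r: "poly (map_poly of_int f') z = 0"
    using f(3) f'(1) by (auto simp: of_int_poly_hom.hom_uminus)
  moreover have "degree f' > 0"
  proof (rule ccontr)
    assume "\<not> degree f' > 0"
    then obtain c where "f' = [:c:]" by (auto elim!: degree_eq_zeroE)
    then show False using r f'(2) by (simp add: of_int_hom.map_poly_pCons_hom)
  qed
  ultimately show ?thesis using that f'(2) by blast
qed

text \<open>A root shared with the derivative would make \<open>f\<close> divide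
  \<open>pderiv f\<close>, which is nonzero and of smaller degree.\<close>

lemma prime_elem_rsquarefree:
  fixes f :: "int poly"
  assumes "prime_elem f" "degree f > 0"
  shows "rsquarefree (map_poly complex_of_int f)"
  unfolding rsquarefree_roots
proof (intro allI notI)
  fix z assume z: "poly (map_poly complex_of_int f) z = 0 \<and> poly (pderiv (map_poly of_int f)) z = 0"
  then have "f dvd pderiv f"
    using assms(1) by (intro prime_elem_dvd_if_common_root[of f z]) (auto simp: of_int_hom.map_poly_pderiv)
  moreover have "pderiv f \<noteq> 0" using assms(2) by (simp add: pderiv_eq_0_iff)
  ultimately have "degree f \<le> degree (pderiv f)" by (rule dvd_imp_degree_le)
  then show False using assms(2) by (simp add: degree_pderiv)
qed

text \<open>This is \<open>f\<^sup>*\<close> only when \<open>f(0) = \<plusminus>1\<close>, since \<open>f(0)\<close> replaces its inverse.\<close>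

definition reciprocal_poly :: "int poly \<Rightarrow> int poly" where
  "reciprocal_poly f = Polynomial.smult (coeff f 0) (reflect_poly f)"

text \<open>Take the monic prime factor \<open>f\<close> with root \<open>z\<close>. Its roots are
  simple, so \<open>z\<close> is still a root of the cofactor \<open>G\<close>, and
  \<open>F = f * f * H\<close>. As \<open>F\<close> is its own reflection, \<open>f\<close> divides
  the reflection of \<open>f\<close> or that of \<open>G\<close>. In the first case \<open>f\<close>
  equals its reciprocal; in the second, reflecting \<open>f * G\<close> exhibits both
  \<open>f\<close> and its reciprocal as factors.\<close>

lemma palindromic_split_factor:
  fixes F :: "int poly" and z :: complex
  assumes monic: "lead_coeff F = 1" and pal: "reflect_poly F = F"
    and ord: "Polynomial.order z (map_poly of_int F) \<ge> 2" and z: "z \<noteq> 1" "z \<noteq> -1"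
  obtains f F' where "lead_coeff f = 1" "degree f > 0" "rsquarefree (map_poly complex_of_int f)"
    "poly f 1 \<noteq> 0" "poly f (-1) \<noteq> 0" "F = f * reciprocal_poly f * F'"
proof -
  have F0: "map_poly complex_of_int F \<noteq> 0" using monic by auto
  have root: "poly (map_poly of_int F) z = 0" using ord F0 by (simp add: order_root)
  obtain f where f: "prime_elem f" "f dvd F" "poly (map_poly of_int f) z = 0" "lead_coeff f = 1" "degree f > 0"
    using exists_monic_prime_factor_with_root[OF monic root] .
  note sqf = prime_elem_rsquarefree[OF f(1,5)]
  obtain G where G: "F = f * G" using f(2) by blast
  have "Polynomial.order z (map_poly of_int F)
      = Polynomial.order z (map_poly of_int f) + Polynomial.order z (map_poly of_int G)"
    using F0 unfolding G map_poly_mult_of_int by (rule order_mult)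
  moreover have "Polynomial.order z (map_poly of_int f) \<le> 1"
    using sqf by (metis rsquarefree_def le_numeral_extra(4) zero_le)
  ultimately have "Polynomial.order z (map_poly of_int G) \<noteq> 0" using ord by linarith
  then have "poly (map_poly of_int G) z = 0" by (meson order_root)
  then obtain H where H: "G = f * H" using prime_elem_dvd_if_common_root[OF f(1,3)] by blast
  have "coeff F 0 = 1" using arg_cong[OF pal, of "\<lambda>p. coeff p 0"] monic by simp
  then have "coeff f 0 * coeff G 0 = 1" by (simp add: G coeff_mult_0)
  then have unit: "coeff f 0 * coeff f 0 = 1" by (auto simp: zmult_eq_1_iff)
  have "f dvd reflect_poly f * reflect_poly G"
    using f(2) pal by (simp add: G reflect_poly_mult)
  then have "f dvd reflect_poly f \<or> f dvd reflect_poly G" using f(1) prime_elem_dvd_multD by blast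
  then have "\<exists>F'. F = f * reciprocal_poly f * F'"
  proof
    assume "f dvd reflect_poly f"
    then obtain u where u: "reflect_poly f = f * u" by blast
    have "coeff f 0 \<noteq> 0" using unit by auto
    then have deg: "degree (reflect_poly f) = degree f" by simp
    have "u \<noteq> 0" using u f(1) by auto
    then have "degree u = 0" using arg_cong[OF u, of degree] f(1) deg by (simp add: degree_mult_eq)
    then obtain c where c: "u = [:c:]" by (auto elim!: degree_eq_zeroE)
    have "coeff (reflect_poly f) (degree f) = coeff f 0" by (simp add: coeff_reflect_poly)
    then have "c = coeff f 0" using u c f(4) by simp
    then have "reciprocal_poly f = f" using u c unit by (simp add: reciprocal_poly_def)
    then show ?thesis using G H by (auto simp: mult.assoc)
  next
    assume "f dvd reflect_poly G"
    then obtain K where K: "reflect_poly G = f * K" by blast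
    have "F = reflect_poly (f * G)" using pal G by simp
    also have "\<dots> = reflect_poly f * (f * K)" by (simp only: reflect_poly_mult K)
    also have "\<dots> = f * reciprocal_poly f * Polynomial.smult (coeff f 0) K"
      using unit by (simp add: reciprocal_poly_def mult.commute mult.left_commute)
    finally show ?thesis by blast
  qed
  then obtain F' where "F = f * reciprocal_poly f * F'" by blast
  \<comment> \<open>A prime \<open>f\<close> with root \<open>e\<close> would divide X -
    \<open>e\<close>, whose only root is \<open>e\<close>, whereas \<open>f\<close> vanishes at
    \<open>z\<close>.\<close>
  moreover have "poly f e \<noteq> 0" if e: "e = 1 \<or> e = -1" for e :: int
  proof
    assume "poly f e = 0"
    then have "poly (map_poly complex_of_int f) (of_int e) = 0" by simp
    then have "f dvd [:-e, 1:]" using prime_elem_dvd_if_common_root[OF f(1), of "of_int e" "[:-e, 1:]"]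
      by (simp add: of_int_hom.map_poly_pCons_hom)
    then obtain u where u: "[:-e, 1:] = f * u" by blast
    have "poly (map_poly complex_of_int [:-e, 1:]) z = 0"
      using f(3) unfolding u map_poly_mult_of_int by simp
    then show False using z e by (auto simp: of_int_hom.map_poly_pCons_hom)
  qed
  ultimately show ?thesis using that f(4,5) sqf by blast
qed

section \<open>Values at 1 and -1 and the square conditions\<close>

lemma map_poly_of_int_reflect:
  "map_poly (of_int :: int \<Rightarrow> 'a :: {ring_char_0,idom}) (reflect_poly f) = reflect_poly (map_poly of_int f)"
  by (rule poly_eqI) (simp add: coeff_reflect_poly coeff_map_poly)

lemma poly_reflect_poly_unit:
  fixes e :: int
  assumes "e * e = 1"
  shows "poly (reflect_poly p) e = e ^ degree p * poly p e"
proof -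
  have e: "rat_of_int e * of_int e = 1" using assms by (metis of_int_1 of_int_mult)
  then have e0: "rat_of_int e \<noteq> 0" and inv: "inverse (rat_of_int e) = of_int e"
    by (auto intro: inverse_unique)
  have "rat_of_int (poly (reflect_poly p) e) = poly (reflect_poly (map_poly of_int p)) (of_int e)"
    by (simp flip: map_poly_of_int_reflect)
  also have "\<dots> = of_int (e ^ degree p * poly p e)"
    using poly_reflect_poly_nz[OF e0, of "map_poly of_int p"] by (simp add: inv)
  finally show ?thesis by (simp only: of_int_eq_iff)
qed

text \<open>Multiplication by \<delta> turns the equation into
  \<open>u^2 * (\<delta> * e * y) = a^2\<close>, so \<open>u\<close> divides \<open>a\<close> and
  cancels. It is applied with \<open>u\<close> the value of \<open>f\<close> at 1 or -1, to carry
  the square condition from \<open>F\<close> to \<open>F'\<close>; at \<open>u = 0\<close> the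
  equation says nothing about \<open>y\<close>, whence the last assumption.\<close>

lemma square_class_quotient:
  fixes u y e \<delta> a :: int
  assumes "u * u * (e * y) = \<delta> * a^2" "e * e = 1" "\<delta> * \<delta> = 1" "u = 0 \<Longrightarrow> y = 0"
  shows "\<exists>a'. y = \<delta> * e * a'^2"
proof (cases "u = 0")
  case True
  then show ?thesis using assms(4) by (intro exI[of _ 0]) simp
next
  case False
  have eq: "u^2 * (\<delta> * e * y) = a^2"
  proof -
    have "u^2 * (\<delta> * e * y) = \<delta> * (u * u * (e * y))" by (simp add: power2_eq_square)
    also have "\<dots> = (\<delta> * \<delta>) * a^2" by (simp add: assms(1))
    finally show ?thesis by (simp add: assms(3))
  qed
  then have "u^2 dvd a^2" by (metis dvd_triv_left)
  then obtain a' where a': "a = u * a'" by (auto elim!: dvdE)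
  have "\<delta> * e * y = a'^2" using eq False by (simp add: a' power_mult_distrib)
  then have "(\<delta> * \<delta>) * (e * e) * y = \<delta> * e * a'^2" by (simp add: ac_simps)
  then show ?thesis using assms(2,3) by auto
qed

text \<open>At 1 and -1 the reciprocal of \<open>f\<close> agrees with \<open>f\<close> up to sign,
  so \<open>F\<close> and \<open>F'\<close> differ there by a sign and a square. The new common sign
  is \<open>\<delta> * coeff f 0\<close>.\<close>

lemma palindromic_quotient:
  fixes F :: "int poly"
  assumes monic: "lead_coeff F = 1" and pal: "reflect_poly F = F" and deg: "degree F = 2 * n"
    and F: "F = f * reciprocal_poly f * F'" and f: "lead_coeff f = 1"
    and "\<delta> * \<delta> = 1" "poly F 1 = \<delta> * a^2" "(-1) ^ n * poly F (-1) = \<delta> * b^2"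
    and z1: "poly f 1 = 0 \<Longrightarrow> poly F' 1 = 0" and z2: "poly f (-1) = 0 \<Longrightarrow> poly F' (-1) = 0"
  shows "coeff f 0 * coeff f 0 = 1" "degree f \<le> n" "lead_coeff F' = 1" "reflect_poly F' = F'"
    "degree F' = 2 * (n - degree f)"
    "\<exists>\<delta> a b. \<delta> * \<delta> = 1 \<and> poly F' 1 = \<delta> * a^2 \<and> (-1) ^ (n - degree f) * poly F' (-1) = \<delta> * b^2"
proof -
  have "coeff F 0 = 1" using arg_cong[OF pal, of "\<lambda>p. coeff p 0"] monic by simp
  then have "coeff f 0 * (coeff f 0 * coeff F' 0) = 1" using f by (simp add: F coeff_mult_0 reciprocal_poly_def)
  then show unit: "coeff f 0 * coeff f 0 = 1" by (auto simp: zmult_eq_1_iff)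
  then have f0: "coeff f 0 \<noteq> 0" by auto
  have nz: "f \<noteq> 0" "reciprocal_poly f \<noteq> 0" "F' \<noteq> 0" using monic F by auto
  have dc: "degree (reciprocal_poly f) = degree f" using f0 by (simp add: reciprocal_poly_def)
  have lc: "lead_coeff (reciprocal_poly f) = 1" using f0 unit dc by (simp add: reciprocal_poly_def coeff_reflect_poly)
  show lF': "lead_coeff F' = 1" using monic f lc unfolding F by (simp add: lead_coeff_mult)
  have dF: "2 * n = degree f + degree f + degree F'"
    using deg nz dc by (simp add: F degree_mult_eq)
  then show le: "degree f \<le> n" and "degree F' = 2 * (n - degree f)" by auto
  have rc: "reflect_poly (reciprocal_poly f) = Polynomial.smult (coeff f 0) f" 
    using f0 by (simp add: reciprocal_poly_def reflect_poly_smult)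
  have "f * reciprocal_poly f * reflect_poly F' = reflect_poly F"
    unfolding F reflect_poly_mult rc by (simp add: reciprocal_poly_def mult.commute)
  also have "\<dots> = f * reciprocal_poly f * F'" using pal F by simp
  finally show "reflect_poly F' = F'" using nz by simp
  have e1: "poly (reciprocal_poly f) 1 = coeff f 0 * poly f 1"
    by (simp add: reciprocal_poly_def poly_reflect_poly_unit)
  have e2: "poly (reciprocal_poly f) (-1) = coeff f 0 * ((-1) ^ degree f * poly f (-1))"
    by (simp add: reciprocal_poly_def poly_reflect_poly_unit)
  have "poly f 1 * poly f 1 * (coeff f 0 * poly F' 1) = \<delta> * a^2"
    using assms(7) by (simp add: F e1 ac_simps)
  from square_class_quotient[OF this unit assms(6) z1]
  obtain a' where a': "poly F' 1 = \<delta> * coeff f 0 * a'^2" by blast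
  \<comment> \<open>Reflection contributes the sign \<open>(-1) ^ degree f\<close> at -1. It
    compensates the drop of the exponent from \<open>n\<close> to \<open>n - degree f\<close>, so
    the signs at 1 and -1 stay equal.\<close>
  have "(-1 :: int) ^ n = (-1) ^ (n - degree f) * (-1) ^ degree f"
    using le by (simp flip: power_add)
  then have "poly f (-1) * poly f (-1) * (coeff f 0 * ((-1) ^ (n - degree f) * poly F' (-1)))
      = (-1) ^ n * poly F (-1) * ((-1) ^ degree f * (-1) ^ degree f * (-1) ^ degree f * (-1) ^ degree f)"
    by (simp add: F e2 ac_simps flip: power_mult_distrib)
  also have "\<dots> = \<delta> * b^2" using assms(8) by (simp flip: power_mult_distrib mult.assoc)
  finally obtain b' where "(-1) ^ (n - degree f) * poly F' (-1) = \<delta> * coeff f 0 * b'^2"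
    using square_class_quotient[OF _ unit assms(6)] z2 by (metis mult_zero_right)
  moreover have "(\<delta> * coeff f 0) * (\<delta> * coeff f 0) = (\<delta> * \<delta>) * (coeff f 0 * coeff f 0)"
    by (simp add: ac_simps)
  ultimately show "\<exists>\<delta> a b. \<delta> * \<delta> = 1 \<and> poly F' 1 = \<delta> * a^2 \<and> (-1) ^ (n - degree f) * poly F' (-1) = \<delta> * b^2"
    using a' unit assms(6) by (intro exI[of _ "\<delta> * coeff f 0"] exI[of _ a'] exI[of _ b']) simp
qed

section \<open>Normal form of a palindromic polynomial\<close>

text \<open>The indices \<open>d - i\<close> and \<open>d + 2 + i\<close> are mirror images in the
  middle index \<open>d + 1\<close>, so coefficients of an antipalindromic polynomial of degree
  \<open>2*d+2\<close> pair up.\<close>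

lemma sum_symmetric_split:
  fixes g :: "nat \<Rightarrow> 'a :: comm_monoid_add"
  shows "(\<Sum>i\<le>2*d+2. g i) = g 0 + (\<Sum>i<d. g (d - i)) + g (d+1) + (\<Sum>i<d. g (d+2+i)) + g (2*d+2)"
proof -
  have split: "(\<Sum>i<n+m. g i) = (\<Sum>i<n. g i) + (\<Sum>i<m. g (n+i))" for n m
    by (induction m) (simp_all add: ac_simps)
  have "(\<Sum>i\<le>2*d+2. g i) = (\<Sum>i<(d+2)+d. g i) + g (2*d+2)"
  proof -
    have "(d+2)+d = 2*d+2" by simp
    then show ?thesis by (simp only: lessThan_Suc_atMost[symmetric] sum.lessThan_Suc)
  qed
  also have "(\<Sum>i<(d+2)+d. g i) = (\<Sum>i<Suc (Suc d). g i) + (\<Sum>i<d. g (d+2+i))"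
    unfolding split[of "d+2" d] by simp
  also have "(\<Sum>i<Suc (Suc d). g i) = g 0 + (\<Sum>i<d. g (Suc i)) + g (d+1)"
    by (simp only: sum.lessThan_Suc[of _ "Suc d"] sum.lessThan_Suc_shift[of _ d]) simp
  also have "(\<Sum>i<d. g (Suc i)) = (\<Sum>i<d. g (Suc (d - Suc i)))"
    by (rule sum.nat_diff_reindex[symmetric])
  also have "\<dots> = (\<Sum>i<d. g (d - i))" by (intro sum.cong) (auto simp: Suc_diff_Suc)
  finally show ?thesis .
qed

text \<open>Subtract from \<open>F\<close> a palindromic trinomial \<open>K\<close> with the same
  values at 1 and -1. The difference is divisible by X^2 - 1, with an antipalindromic quotient
  \<open>P\<close> whose free coefficients are the \<open>c (Suc i)\<close>.\<close>

lemma palindromic_normal_form: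
  fixes F :: "int poly"
  assumes monic: "lead_coeff F = 1" and pal: "reflect_poly F = F" and deg: "degree F = 2 * (d+2)"
    and \<delta>: "\<delta> * \<delta> = 1" and F1: "poly F 1 = \<delta> * a^2" and F2: "(-1) ^ (d+2) * poly F (-1) = \<delta> * b^2"
  shows "\<exists>(c :: nat \<Rightarrow> int) \<alpha> \<beta>. \<forall>z :: complex. poly (map_poly of_int F) z =
      (z^2 - 1) * (z ^ (2*d+2) - 1 - (\<Sum>i<d. of_int (c (Suc i)) * (z ^ (d+2+i) - z ^ (d - i))))
      + z ^ (d+1) * (of_int (\<alpha> * \<beta>) * (z^2 + 1) + of_int \<delta> * of_int (\<alpha>^2 + \<beta>^2) * z)"
proof -
  have "\<delta> = 1 \<or> \<delta> = -1" using \<delta> by (auto simp: zmult_eq_1_iff)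
  then have odd: "odd \<delta>" by auto
  \<comment> \<open>The values of \<open>F\<close> at 1 and -1 agree modulo 2 and \<delta> is odd,
    so \<open>a\<close> and \<open>b\<close> have equal parity and \<open>\<alpha>\<close> = (a +
    b)/2, \<open>\<beta>'\<close> = (a - b)/2 are integers.\<close>
  have "even (poly F 1 - poly F (-1))"
    by (induction F) auto
  moreover have "poly F (-1) = (-1) ^ (d+2) * (\<delta> * b^2)" using F2 by (simp flip: F2 mult.assoc power_mult_distrib)
  ultimately have "even (a + b)" using odd F1 by simp
  then obtain \<alpha> where \<alpha>: "a + b = 2 * \<alpha>" by blast
  define \<beta>' where "\<beta>' = \<alpha> - b"
  define \<beta> where "\<beta> = \<delta> * \<beta>'"
  have ab: "a = \<alpha> + \<beta>'" "b = \<alpha> - \<beta>'" using \<alpha> by (auto simp: \<beta>'_def)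
  define \<gamma> where "\<gamma> = \<delta> * (\<alpha>^2 + \<beta>^2)"
  have dd: "\<delta> * (\<delta> * x) = x" for x using \<delta> by (simp flip: mult.assoc)
  have sq1: "2 * \<alpha> * \<beta> + \<gamma> = \<delta> * a^2" and sq2: "2 * \<alpha> * \<beta> - \<gamma> = - (\<delta> * b^2)"
    by (simp_all add: \<gamma>_def \<beta>_def ab power2_eq_square algebra_simps dd)
  \<comment> \<open>Centred at degree \<open>d + 2\<close> like \<open>F\<close>; by
    \<open>sq1\<close> and \<open>sq2\<close> it interpolates \<open>F\<close> at 1 and -1.\<close>
  define K where "K = monom (\<alpha> * \<beta>) (d+1) + monom \<gamma> (d+2) + monom (\<alpha> * \<beta>) (d+3)"
  have "poly K 1 = 2 * \<alpha> * \<beta> + \<gamma>" by (simp add: K_def poly_monom)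
  then have K1: "poly (F - K) 1 = 0" using F1 sq1 by simp
  have "poly K (-1) = - ((-1) ^ d * (2 * \<alpha> * \<beta> - \<gamma>))"
    by (simp add: K_def poly_monom algebra_simps numeral_3_eq_3)
  then have K2: "poly (F - K) (-1) = 0"
    using \<open>poly F (-1) = _\<close> sq2 by simp
  have "[:-1, 1:] dvd F - K" using K1 poly_eq_0_iff_dvd[of "F - K" 1] by simp
  then obtain Q where Q: "F - K = [:-1, 1:] * Q" by (rule dvdE)
  have "poly Q (-1) = 0" using K2 unfolding Q by simp
  then have "[:1, 1:] dvd Q" using poly_eq_0_iff_dvd[of Q "-1"] by simp
  then obtain P where P: "Q = [:1, 1:] * P" by (rule dvdE)
  have FK: "F - K = [:-1, 0, 1:] * P" unfolding Q P by (simp add: algebra_simps)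
  have cK: "coeff K i = (if i = d+1 \<or> i = d+3 then \<alpha> * \<beta> else if i = d+2 then \<gamma> else 0)" for i
    by (auto simp: K_def)
  have dK: "degree K < 2 * (d+2)"
    by (rule le_less_trans[of _ "d+3"]) (auto intro!: degree_le simp: cK)
  have dFK: "degree (F - K) = 2 * (d+2)"
    using degree_add_eq_left[of "- K" F] dK deg by simp
  have cF: "coeff F (2 * (d+2) - i) = coeff F i" if "i \<le> 2 * (d+2)" for i
    using arg_cong[OF pal, of "\<lambda>p. coeff p i"] that deg by (simp add: coeff_reflect_poly)
  have "reflect_poly (F - K) = F - K"
  proof (rule poly_eqI)
    fix i
    show "coeff (reflect_poly (F - K)) i = coeff (F - K) i"
    proof (cases "i \<le> 2 * (d+2)")
      case True
      have "coeff K (2 * (d+2) - i) = coeff K i" using True by (auto simp: cK)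
      then show ?thesis using True cF by (simp add: coeff_reflect_poly dFK)
    next
      case False
      then have "coeff (F - K) i = 0" by (intro coeff_eq_0) (simp add: dFK)
      then show ?thesis using False by (simp add: coeff_reflect_poly dFK)
    qed
  qed
  then have "reflect_poly [:-1, 0, 1:] * reflect_poly P = [:-1, 0, 1:] * P"
    unfolding FK reflect_poly_mult .
  moreover have "reflect_poly [:-1, 0, 1 :: int:] = - [:-1, 0, 1:]"
    by (simp add: reflect_poly_pCons)
  ultimately have "[:-1, 0, 1:] * (- reflect_poly P) = [:-1, 0, 1:] * P"
    by (simp only: mult_minus_left mult_minus_right)
  \<comment> \<open>Reflection negates X^2 - 1 and fixes \<open>F - K\<close>, so it negates the
    quotient.\<close>
  then have rP: "reflect_poly P = - P" by (simp only: mult_cancel_left) auto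
  have "F - K \<noteq> 0" using dFK by auto
  then have P0: "P \<noteq> 0" using FK by auto
  have dP: "degree P = 2*d+2" using dFK P0 unfolding FK by (subst (asm) degree_mult_eq) auto
  have "coeff (F - K) (2 * (d+2)) = 1" using monic deg dK by (simp add: coeff_eq_0)
  then have "lead_coeff (F - K) = 1" by (simp add: dFK)
  then have lP: "coeff P (2*d+2) = 1" unfolding FK lead_coeff_mult by (simp add: dP)
  have cP: "coeff P (2*d+2 - i) = - coeff P i" if "i \<le> 2*d+2" for i
    using arg_cong[OF rP, of "\<lambda>p. coeff p i"] that dP by (simp add: coeff_reflect_poly)
  \<comment> \<open>\<open>c j\<close> is the coefficient at distance \<open>j\<close> below the
    middle degree. Antisymmetry gives its negative at distance \<open>j\<close> above and kills the
    middle one.\<close>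
  define c where "c j = coeff P (d+1 - j)" for j
  have mid: "coeff P (d+1) = 0" using cP[of "d+1"] by simp
  have P_0: "coeff P 0 = -1" using cP[of 0] lP by simp
  have up: "coeff P (d+2+i) = - c (Suc i)" if "i < d" for i
    using cP[of "d - i"] that by (simp add: c_def)
  have Pz: "poly (map_poly of_int P) z
      = z ^ (2*d+2) - 1 - (\<Sum>i<d. of_int (c (Suc i)) * (z ^ (d+2+i) - z ^ (d - i)))" for z :: complex
  proof -
    have "poly (map_poly of_int P) z = (\<Sum>i\<le>2*d+2. of_int (coeff P i) * z ^ i)"
      by (simp add: poly_altdef dP)
    also have "\<dots> = -1 + (\<Sum>i<d. of_int (c (Suc i)) * z ^ (d - i))
        + (\<Sum>i<d. of_int (coeff P (d+2+i)) * z ^ (d+2+i)) + z ^ (2*d+2)"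
      unfolding sum_symmetric_split mid lP P_0 by (simp add: c_def)
    also have "(\<Sum>i<d. of_int (coeff P (d+2+i)) * z ^ (d+2+i))
        = (\<Sum>i<d. - (of_int (c (Suc i)) * z ^ (d+2+i)))"
      by (intro sum.cong refl, subst up) simp_all
    finally show ?thesis by (simp add: right_diff_distrib sum_subtractf sum_negf)
  qed
  have "poly (map_poly of_int F) z =
      (z^2 - 1) * (z ^ (2*d+2) - 1 - (\<Sum>i<d. of_int (c (Suc i)) * (z ^ (d+2+i) - z ^ (d - i))))
      + z ^ (d+1) * (of_int (\<alpha> * \<beta>) * (z^2 + 1) + of_int \<delta> * of_int (\<alpha>^2 + \<beta>^2) * z)" for z :: complex
  proof -
    have F: "F = [:-1, 0, 1:] * P + K" using FK by (metis diff_add_cancel)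
    have "poly (map_poly complex_of_int [:-1, 0, 1:]) z = z^2 - 1"
      by (simp add: of_int_hom.map_poly_pCons_hom power2_eq_square)
    moreover have "poly (map_poly complex_of_int K) z
        = z ^ (d+1) * (of_int (\<alpha> * \<beta>) * (z^2 + 1) + of_int \<delta> * of_int (\<alpha>^2 + \<beta>^2) * z)"
      unfolding K_def of_int_poly_hom.hom_add
      by (simp add: map_poly_monom poly_monom \<gamma>_def algebra_simps numeral_3_eq_3 power2_eq_square)
    ultimately show ?thesis
      unfolding Pz[symmetric] by (subst F) (simp only: of_int_poly_hom.hom_add map_poly_mult_of_int poly_add poly_mult)
  qed
  then show ?thesis by blast
qed

lemma order_of_int:
  assumes "p \<noteq> 0"
  shows "Polynomial.order (of_int e) (map_poly complex_of_int p) = Polynomial.order e p"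
proof -
  obtain q where q: "p = [:-e, 1:] ^ Polynomial.order e p * q" "\<not> [:-e, 1:] dvd q"
    using order_decomp[OF assms] by blast
  let ?k = "Polynomial.order e p"
  have "map_poly complex_of_int p = [:- of_int e, 1:] ^ ?k * map_poly of_int q"
    using arg_cong[OF q(1), of "map_poly complex_of_int"]
    by (simp only: map_poly_mult_of_int of_int_poly_hom.hom_power) (simp add: of_int_hom.map_poly_pCons_hom)
  moreover have "poly (map_poly complex_of_int q) (of_int e) \<noteq> 0"
    using q(2) by (simp add: poly_eq_0_iff_dvd)
  moreover have "q \<noteq> 0" using q(2) by auto
  ultimately show ?thesis
    using assms order_mult[of "[:- of_int e, 1:] ^ ?k" "map_poly complex_of_int q" "of_int e"]
    by (simp add: order_power_n_n order_0I)
qed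

section \<open>The isometry with characteristic polynomial \<open>f f\<^sup>*\<close>\<close>

text \<open>The companion matrix of \<open>f\<close> on the even coordinates and its inverse transpose on the odd
  ones; \<open>coeff f 0\<close> stands for its own inverse.\<close>

definition dual_companion :: "int poly \<Rightarrow> (nat \<Rightarrow> 'a) \<Rightarrow> nat \<Rightarrow> 'a :: comm_ring_1" where
  "dual_companion f x r =
     (if even r then (if r = 0 then 0 else x (r - 2)) - of_int (coeff f (r div 2)) * x (2 * (degree f - 1))
      else if r = 1 then - of_int (coeff f 0) * (\<Sum>i<degree f. of_int (coeff f (Suc i)) * x (2*i+1))
      else x (r - 2))"

lemma dual_companion_linear:
  assumes "degree f > 0"
  shows "coordinate_linear (2 * degree f) (dual_companion f)"
proof -
  have "dual_companion f x i = dual_companion f y i"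
    if "i < 2 * degree f" "\<forall>k<2 * degree f. x k = y k" for x y :: "nat \<Rightarrow> 'a" and i
  proof -
    have "(\<Sum>i<degree f. of_int (coeff f (Suc i)) * x (2*i+1))
        = (\<Sum>i<degree f. of_int (coeff f (Suc i)) * y (2*i+1))"
      using that by (intro sum.cong) auto
    moreover have "x (i - 2) = y (i - 2)" "x (2 * (degree f - 1)) = y (2 * (degree f - 1))"
      using that assms by auto
    ultimately show ?thesis by (simp add: dual_companion_def)
  qed
  then show ?thesis
    by (auto simp: coordinate_linear_def dual_companion_def algebra_simps sum.distrib sum_distrib_left)
qed

text \<open>The form is \<open>B x y + B y x\<close>, where \<open>B\<close> pairs even with odd
  coordinates. \<open>B\<close> is preserved because the operators on the two halves are inverse
  transposes: the product of the coordinates 0 and 1 cancels the correction terms of the shifted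
  sum.\<close>

lemma dual_companion_isometry:
  fixes x y :: "nat \<Rightarrow> int"
  assumes deg: "degree f = Suc d" and monic: "coeff f (Suc d) = 1" and unit: "coeff f 0 * coeff f 0 = 1"
  shows "pair_form (degree f) (dual_companion f x) (dual_companion f y) = pair_form (degree f) x y"
proof -
  define B where "B x y = (\<Sum>i<Suc d. x (2*i) * y (2*i+1))" for x y :: "nat \<Rightarrow> int"
  have pf: "pair_form (degree f) x y = B x y + B y x" for x y
    by (simp add: pair_form_def B_def deg sum.distrib algebra_simps)
  have "B (dual_companion f x) (dual_companion f y) = B x y" for x y
  proof -
    have "B (dual_companion f x) (dual_companion f y)
      = dual_companion f x 0 * dual_companion f y 1
        + (\<Sum>i<d. dual_companion f x (2 * Suc i) * dual_companion f y (2 * Suc i + 1))"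
      by (simp add: B_def sum.lessThan_Suc_shift del: sum.lessThan_Suc)
    also have "dual_companion f x 0 * dual_companion f y 1
        = (coeff f 0 * coeff f 0) * x (2*d) * (\<Sum>i<Suc d. coeff f (Suc i) * y (2*i+1))"
      by (simp add: dual_companion_def deg algebra_simps del: sum.lessThan_Suc)
    also have "\<dots> = (\<Sum>i<d. coeff f (Suc i) * x (2*d) * y (2*i+1)) + x (2*d) * y (2*d+1)"
      by (simp add: unit monic algebra_simps sum_distrib_left)
    also have "(\<Sum>i<d. dual_companion f x (2 * Suc i) * dual_companion f y (2 * Suc i + 1))
        = (\<Sum>i<d. x (2*i) * y (2*i+1)) - (\<Sum>i<d. coeff f (Suc i) * x (2*d) * y (2*i+1))"
      unfolding sum_subtractf[symmetric]
      by (intro sum.cong refl) (simp add: dual_companion_def deg algebra_simps)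
    finally show ?thesis by (simp add: B_def)
  qed
  then show ?thesis by (simp add: pf)
qed

lemma reflect_prod_linear:
  fixes R :: "complex set"
  assumes "finite R" "0 \<notin> R"
  shows "reflect_poly (\<Prod>z\<in>R. [:-z, 1:]) = Polynomial.smult (\<Prod>z\<in>R. - z) (\<Prod>z\<in>R. [:- inverse z, 1:])"
proof -
  have "reflect_poly [:-z, 1:] = Polynomial.smult (- z) [:- inverse z, 1:]" if "z \<in> R" for z
  proof -
    have "z \<noteq> 0" using that assms by auto
    then show ?thesis by (subst reflect_poly_pCons) auto
  qed
  then show ?thesis
    by (simp only: reflect_poly_prod prod_smult cong: prod.cong)
qed

lemma rsquarefree_decompose:
  fixes p :: "complex poly"
  assumes "rsquarefree p" "lead_coeff p = 1"
  shows "p = (\<Prod>z|poly p z = 0. [:-z, 1:])" "finite {z. poly p z = 0}"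
    "card {z. poly p z = 0} = degree p"
proof -
  show p: "p = (\<Prod>z|poly p z = 0. [:-z, 1:])"
    using complex_poly_decompose_rsquarefree[OF assms(1)] assms(2) by simp
  show "finite {z. poly p z = 0}"
    using assms(2) by (intro poly_roots_finite) auto
  have "degree (\<Prod>z|poly p z = 0. [:-z, 1:]) = (\<Sum>z|poly p z = 0. degree [:-z, 1:])"
    by (rule degree_prod_sum_eq) auto
  then show "card {z. poly p z = 0} = degree p" using p by simp
qed

text \<open>Each root \<open>z\<close> of \<open>f\<close> yields two eigenvectors: the coefficients
  of f/(X - z) on the even coordinates, with eigenvalue \<open>z\<close>, and the powers of
  \<open>z\<close> on the odd ones, with eigenvalue 1/z.\<close>

lemma hyperbolic_realizes_dual_pair:
  assumes monic: "lead_coeff f = 1" and deg: "degree f > 0" and unit: "coeff f 0 * coeff f 0 = 1"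
    and sqf: "rsquarefree (map_poly complex_of_int f)"
  shows "hyperbolic_realizes (degree f) (f * reciprocal_poly f)"
proof -
  let ?f = "map_poly complex_of_int f" and ?k = "degree f" and ?L = "dual_companion f"
  obtain d where d: "degree f = Suc d" using deg by (cases "degree f") auto
  define R where "R = {z. poly ?f z = 0}"
  have dec: "?f = (\<Prod>z\<in>R. [:-z, 1:])" "finite R" "card R = ?k"
    using rsquarefree_decompose[OF sqf] monic by (auto simp: R_def coeff_map_poly)
  have R0: "z \<noteq> 0" if "z \<in> R" for z
    using that unit by (auto simp: R_def poly_0_coeff_0 coeff_map_poly)
  \<comment> \<open>The recurrence for the coefficients of this quotient is exactly the eigenvector
    equation of the companion matrix.\<close>
  define q where "q z = synthetic_div ?f z" for z
  have fq: "?f = [:-z, 1:] * q z" if "z \<in> R" for z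
    using synthetic_div_correct'[of z ?f] that by (simp add: R_def q_def)
  have qS: "coeff (q z) i = z * coeff (q z) (Suc i) + of_int (coeff f (Suc i))" if "z \<in> R" for z i
    using arg_cong[OF fq[OF that], of "\<lambda>p. coeff p (Suc i)"] by (simp add: coeff_map_poly algebra_simps)
  have q0: "z * coeff (q z) 0 = - of_int (coeff f 0)" if "z \<in> R" for z
    using arg_cong[OF fq[OF that], of "\<lambda>p. coeff p 0"] by (simp add: coeff_map_poly)
  have qd: "coeff (q z) d = 1" if "z \<in> R" for z
  proof -
    have "degree (q z) = d" by (simp add: q_def degree_synthetic_div d)
    then have "coeff (q z) (Suc d) = 0" by (simp add: coeff_eq_0)
    then show ?thesis using qS[OF that, of d] monic d by simp
  qed
  define v where "v s r = (if snd s then (if odd r then fst s ^ (r div 2) else 0)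
      else (if even r then coeff (q (fst s)) (r div 2) else 0))" for s and r :: nat
  define ev where "ev s = (if snd s then inverse (fst s) else fst s)" for s :: "complex \<times> bool"
  \<comment> \<open>An eigenvalue may occur once in each half. The halves have disjoint supports, so
    a coordinate with value 1 in the right half separates the two vectors.\<close>
  define \<kappa> where "\<kappa> s = (if snd s then 1 else 2 * d)" for s :: "complex \<times> bool"
  show ?thesis
  proof (rule hyperbolic_realizes_operator[of ?k ?L ?L "R \<times> UNIV" v ev \<kappa>])
    show "coordinate_linear (2 * ?k) (?L :: (nat \<Rightarrow> int) \<Rightarrow> _)"
      "coordinate_linear (2 * ?k) (?L :: (nat \<Rightarrow> complex) \<Rightarrow> _)"
      using deg by (rule dual_companion_linear)+
    show "?L (\<lambda>k. complex_of_int (x k)) i = of_int (?L x i)" for x i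
      by (simp add: dual_companion_def)
    show "pair_form ?k (?L x) (?L y) = pair_form ?k x y" for x y :: "nat \<Rightarrow> int"
      using dual_companion_isometry[OF d] monic unit d by simp
    show "finite (R \<times> (UNIV :: bool set))" "card (R \<times> (UNIV :: bool set)) = 2 * ?k"
      using dec by (simp_all add: card_cartesian_product)
    show "?L (v s) i = ev s * v s i" if sR: "s \<in> R \<times> UNIV" for s i
    proof -
      obtain z b where s: "s = (z, b)" "z \<in> R" using sR by auto
      note z = R0[OF s(2)]
      have "(\<Sum>j\<le>?k. of_int (coeff f j) * z ^ j) = 0"
        using s(2) by (simp add: R_def poly_altdef coeff_map_poly)
      then have root: "z * (\<Sum>j<Suc d. of_int (coeff f (Suc j)) * z ^ j) = - of_int (coeff f 0)"
        unfolding d lessThan_Suc_atMost[symmetric]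
        by (subst (asm) sum.lessThan_Suc_shift)
          (simp add: sum_distrib_left algebra_simps add_eq_0_iff del: sum.lessThan_Suc)
      have unitC: "complex_of_int (coeff f 0) * of_int (coeff f 0) = 1"
        using unit by (metis of_int_1 of_int_mult)
      show ?thesis
      proof (cases b)
        case True
        consider "even i" | "i = 1" | j where "i = 2 * Suc j + 1"
          by (metis One_nat_def Suc_eq_plus1 not0_implies_Suc oddE mult_0_right add_0)
        then show ?thesis
        proof cases
          case 2
          have "z * ?L (v s) 1 = - of_int (coeff f 0) * (z * (\<Sum>j<Suc d. of_int (coeff f (Suc j)) * z ^ j))"
            by (simp add: dual_companion_def v_def s True d del: sum.lessThan_Suc)
          also have "\<dots> = 1" using unitC by (simp only: root) simp
          finally show ?thesis using 2 z by (simp add: v_def ev_def s True field_simps)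
        next
          case 3
          then show ?thesis using z by (simp add: dual_companion_def v_def ev_def s True)
        qed (simp add: dual_companion_def v_def s True)
      next
        case False
        consider "odd i" | "i = 0" | j where "i = 2 * Suc j"
          by (metis evenE mult_0_right not0_implies_Suc)
        then show ?thesis
        proof cases
          case 2
          then show ?thesis
            by (simp add: dual_companion_def v_def ev_def s False d q0 qd)
        next
          case 3
          then show ?thesis
            using qS[OF s(2), of j] by (simp add: dual_companion_def v_def ev_def s False d qd)
        qed (auto simp: dual_companion_def v_def s False elim!: oddE)
      qed
    qed
    show "\<kappa> s < 2 * ?k \<and> v s (\<kappa> s) \<noteq> 0" if "s \<in> R \<times> UNIV" for s
      using that by (auto simp: \<kappa>_def v_def d qd)
    show "v t (\<kappa> s) = 0" if "s \<in> R \<times> UNIV" "t \<in> R \<times> UNIV" "s \<noteq> t" "ev s = ev t" for s t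
      using that by (cases s; cases t) (auto simp: \<kappa>_def v_def ev_def split: if_splits)
    have "of_int (coeff f 0) = coeff (\<Prod>z\<in>R. [:-z, 1:]) 0"
      using arg_cong[OF dec(1), of "\<lambda>p. coeff p 0"] by (simp add: coeff_map_poly)
    also have "\<dots> = (\<Prod>z\<in>R. - z)" by (simp add: poly_prod flip: poly_0_coeff_0)
    finally have c0: "of_int (coeff f 0) = (\<Prod>z\<in>R. - z)" .
    have "reflect_poly ?f = Polynomial.smult (of_int (coeff f 0)) (\<Prod>z\<in>R. [:- inverse z, 1:])"
      unfolding c0 by (subst dec(1)) (use R0 dec(2) in \<open>blast intro: reflect_prod_linear\<close>)
    then have "Polynomial.smult (of_int (coeff f 0)) (reflect_poly ?f) = (\<Prod>z\<in>R. [:- inverse z, 1:])"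
      using unit by (simp flip: of_int_mult)
    then have "map_poly complex_of_int (f * reciprocal_poly f)
        = (\<Prod>z\<in>R. [:-z, 1:]) * (\<Prod>z\<in>R. [:- inverse z, 1:])"
      using dec(1) by (simp add: reciprocal_poly_def of_int_hom.map_poly_hom_smult of_int_poly_hom.hom_mult map_poly_of_int_reflect
          del: mult_smult_right)
    also have "\<dots> = (\<Prod>z\<in>R. \<Prod>b\<in>UNIV. [:- ev (z, b), 1:])"
      unfolding prod.distrib[symmetric]
      by (intro prod.cong refl) (simp add: UNIV_bool ev_def algebra_simps)
    also have "\<dots> = (\<Prod>s\<in>R \<times> UNIV. [:- ev s, 1:])"
      by (simp add: prod.cartesian_product)
    finally show "map_poly complex_of_int (f * reciprocal_poly f)
        = (\<Prod>s\<in>R \<times> UNIV. [:- ev s, 1:])" .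
  qed
qed

section \<open>The regular isometry\<close>

text \<open>With \<open>e\<^sub>0, \<dots>, e\<^sub>d, e\<close> at the even and \<open>f\<^sub>0, \<dots>, f\<^sub>d, f\<close> at the odd coordinates, this is the
  composition of the isometry \<open>e\<^sub>0 \<mapsto> \<dots> \<mapsto> e\<^sub>d \<mapsto> f\<^sub>0 \<mapsto> \<dots> \<mapsto> f\<^sub>d \<mapsto> e\<^sub>0\<close>, \<open>e \<mapsto> \<delta> f\<close>, \<open>f \<mapsto> \<delta> e\<close>
  with the Eichler transvection along the isotropic vector \<open>e\<^sub>0\<close> given by
  \<open>\<alpha> e + \<beta> f + c\<^sub>1 e\<^sub>1 + \<dots> + c\<^sub>d e\<^sub>d \<in> e\<^sub>0\<^sup>\<bottom>\<close>; hence it preserves the form for all parameters.\<close>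

definition regular_operator ::
  "nat \<Rightarrow> (nat \<Rightarrow> int) \<Rightarrow> int \<Rightarrow> int \<Rightarrow> int \<Rightarrow> (nat \<Rightarrow> 'a) \<Rightarrow> nat \<Rightarrow> 'a :: comm_ring_1" where
  "regular_operator d c \<alpha> \<beta> \<delta> x r =
     (if r = 0 then x (2*d+1) - of_int (\<alpha> * \<beta>) * x (2*d) - of_int (\<delta> * \<alpha>) * x (2*d+2)
          - of_int (\<delta> * \<beta>) * x (2*d+3) - (\<Sum>i<d. of_int (c (Suc i)) * x (2*i+1))
      else if r = 1 then x (2*d)
      else if r = 2*d+2 then of_int \<alpha> * x (2*d) + of_int \<delta> * x (2*d+3)
      else if r = 2*d+3 then of_int \<beta> * x (2*d) + of_int \<delta> * x (2*d+2)
      else if even r then x (r - 2) + of_int (c (r div 2)) * x (2*d)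
      else x (r - 2))"

lemma regular_operator_simps:
  "regular_operator d c \<alpha> \<beta> \<delta> x 0 = x (2*d+1) - of_int (\<alpha> * \<beta>) * x (2*d) - of_int (\<delta> * \<alpha>) * x (2*d+2)
          - of_int (\<delta> * \<beta>) * x (2*d+3) - (\<Sum>i<d. of_int (c (Suc i)) * x (2*i+1))"
  "regular_operator d c \<alpha> \<beta> \<delta> x 1 = x (2*d)"
  "regular_operator d c \<alpha> \<beta> \<delta> x (2*d+2) = of_int \<alpha> * x (2*d) + of_int \<delta> * x (2*d+3)"
  "regular_operator d c \<alpha> \<beta> \<delta> x (2*d+3) = of_int \<beta> * x (2*d) + of_int \<delta> * x (2*d+2)"
  "j < d \<Longrightarrow> regular_operator d c \<alpha> \<beta> \<delta> x (2*j+2) = x (2*j) + of_int (c (Suc j)) * x (2*d)"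
  "j < d \<Longrightarrow> regular_operator d c \<alpha> \<beta> \<delta> x (2*j+3) = x (2*j+1)"
proof -
  have "2*j+3 \<noteq> 2*d+2" "2*j+2 \<noteq> 2*d+3" for j by presburger+
  then show
  "regular_operator d c \<alpha> \<beta> \<delta> x 0 = x (2*d+1) - of_int (\<alpha> * \<beta>) * x (2*d) - of_int (\<delta> * \<alpha>) * x (2*d+2)
          - of_int (\<delta> * \<beta>) * x (2*d+3) - (\<Sum>i<d. of_int (c (Suc i)) * x (2*i+1))"
  "regular_operator d c \<alpha> \<beta> \<delta> x 1 = x (2*d)"
  "regular_operator d c \<alpha> \<beta> \<delta> x (2*d+2) = of_int \<alpha> * x (2*d) + of_int \<delta> * x (2*d+3)"
  "regular_operator d c \<alpha> \<beta> \<delta> x (2*d+3) = of_int \<beta> * x (2*d) + of_int \<delta> * x (2*d+2)"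
  "j < d \<Longrightarrow> regular_operator d c \<alpha> \<beta> \<delta> x (2*j+2) = x (2*j) + of_int (c (Suc j)) * x (2*d)"
  "j < d \<Longrightarrow> regular_operator d c \<alpha> \<beta> \<delta> x (2*j+3) = x (2*j+1)"
    by (auto simp: regular_operator_def numeral_3_eq_3)
qed

lemma regular_operator_linear: "coordinate_linear (2 * (d+2)) (regular_operator d c \<alpha> \<beta> \<delta>)"
proof -
  have "regular_operator d c \<alpha> \<beta> \<delta> x i = regular_operator d c \<alpha> \<beta> \<delta> y i"
    if "i < 2 * (d+2)" "\<forall>k<2 * (d+2). x k = y k" for x y :: "nat \<Rightarrow> 'a" and i
  proof -
    have "(\<Sum>i<d. of_int (c (Suc i)) * x (2*i+1)) = (\<Sum>i<d. of_int (c (Suc i)) * y (2*i+1))"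
      using that by (intro sum.cong) auto
    moreover have "x (i - 2) = y (i - 2)" "x (2*d) = y (2*d)" "x (2*d+1) = y (2*d+1)"
      "x (2*d+2) = y (2*d+2)" "x (2*d+3) = y (2*d+3)"
      using that by auto
    ultimately show ?thesis by (simp add: regular_operator_def)
  qed
  then show ?thesis
    by (auto simp: coordinate_linear_def regular_operator_def algebra_simps sum.distrib sum_distrib_left)
qed

text \<open>The operator moves hyperbolic pairs by one place, so the form is split at the front for
  the images and at the back for the arguments. The terms in \<open>c\<close> cancel between the
  first pair and the middle sum, those in \<alpha> and \<beta> between the first and the last
  pair.\<close>

lemma regular_operator_isometry:
  fixes x y :: "nat \<Rightarrow> int"
  assumes "\<delta> * \<delta> = 1"
  shows "pair_form (d+2) (regular_operator d c \<alpha> \<beta> \<delta> x) (regular_operator d c \<alpha> \<beta> \<delta> y)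
    = pair_form (d+2) x y"
proof -
  let ?L = "regular_operator d c \<alpha> \<beta> \<delta>"
  have split: "pair_form (d+2) X Y = (X 0 * Y 1 + X 1 * Y 0)
      + (\<Sum>i<d. X (2*i+2) * Y (2*i+3) + X (2*i+3) * Y (2*i+2))
      + (X (2*d+2) * Y (2*d+3) + X (2*d+3) * Y (2*d+2))" for X Y :: "nat \<Rightarrow> int"
  proof -
    have "(\<Sum>i<d+2. f i) = f 0 + (\<Sum>i<d. f (Suc i)) + f (Suc d)" for f :: "nat \<Rightarrow> int"
      using sum.lessThan_Suc_shift[of f d] by (simp add: ac_simps)
    note shift = this
    show ?thesis
      unfolding pair_form_def shift by (simp add: numeral_3_eq_3)
  qed
  have split': "pair_form (d+2) x y = (\<Sum>i<d. x (2*i) * y (2*i+1) + x (2*i+1) * y (2*i))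
      + (x (2*d) * y (2*d+1) + x (2*d+1) * y (2*d)) + (x (2*d+2) * y (2*d+3) + x (2*d+3) * y (2*d+2))"
    by (simp add: pair_form_def numeral_3_eq_3)
  define sx where "sx = (\<Sum>i<d. c (Suc i) * x (2*i+1))"
  define sy where "sy = (\<Sum>i<d. c (Suc i) * y (2*i+1))"
  have mid: "(\<Sum>i<d. ?L x (2*i+2) * ?L y (2*i+3) + ?L x (2*i+3) * ?L y (2*i+2))
      = (\<Sum>i<d. x (2*i) * y (2*i+1) + x (2*i+1) * y (2*i)) + x (2*d) * sy + y (2*d) * sx"
    unfolding sx_def sy_def sum_distrib_left sum.distrib[symmetric]
    by (intro sum.cong refl, simp only: lessThan_iff regular_operator_simps)
      (simp add: algebra_simps)
  have first: "?L x 0 * ?L y 1 + ?L x 1 * ?L y 0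
      = (x (2*d+1) - \<alpha> * \<beta> * x (2*d) - \<delta> * \<alpha> * x (2*d+2) - \<delta> * \<beta> * x (2*d+3) - sx) * y (2*d)
       + x (2*d) * (y (2*d+1) - \<alpha> * \<beta> * y (2*d) - \<delta> * \<alpha> * y (2*d+2) - \<delta> * \<beta> * y (2*d+3) - sy)"
    unfolding regular_operator_simps(1,2) by (simp add: sx_def sy_def)
  have final: "?L x (2*d+2) * ?L y (2*d+3) + ?L x (2*d+3) * ?L y (2*d+2)
      = (\<alpha> * x (2*d) + \<delta> * x (2*d+3)) * (\<beta> * y (2*d) + \<delta> * y (2*d+2))
       + (\<beta> * x (2*d) + \<delta> * x (2*d+2)) * (\<alpha> * y (2*d) + \<delta> * y (2*d+3))"
    unfolding regular_operator_simps by simp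
  have "\<delta> * (\<delta> * w) = w" for w using assms by (simp flip: mult.assoc)
  note dd = this
  show ?thesis
    unfolding split[of "?L x"] split' mid first final by (simp add: algebra_simps dd)
qed

text \<open>Solution of the eigenvector equations started from the value 1 at coordinate
  \<open>2*d+1\<close>: going down, the odd coordinates become powers of \<open>z\<close>, then the
  even ones collect the \<open>c\<close> in Horner fashion. The values \<open>q\<close> and
  \<open>r\<close> in the last plane are left open.\<close>

definition regular_vector ::
  "nat \<Rightarrow> (nat \<Rightarrow> int) \<Rightarrow> 'a \<Rightarrow> 'a \<Rightarrow> 'a \<Rightarrow> nat \<Rightarrow> 'a :: comm_ring_1" where
  "regular_vector d c z q r k =
     (if k = 2*d+2 then q else if k = 2*d+3 then r
      else if odd k then z ^ (d - k div 2)
      else z ^ (2*d+1 - k div 2)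
        - z ^ (d+1) * (\<Sum>l<d - k div 2. of_int (c (k div 2 + 1 + l)) * z ^ l))"

lemma regular_vector_simps:
  "regular_vector d c z q r (2*d+2) = q"
  "regular_vector d c z q r (2*d+3) = r"
  "i \<le> d \<Longrightarrow> regular_vector d c z q r (2*i+1) = z ^ (d - i)"
  "i \<le> d \<Longrightarrow> regular_vector d c z q r (2*i)
     = z ^ (2*d+1 - i) - z ^ (d+1) * (\<Sum>l<d - i. of_int (c (i + 1 + l)) * z ^ l)"
proof -
  have "2*i+1 \<noteq> 2*d+2" "2*i \<noteq> 2*d+3" for i by presburger+
  then show "regular_vector d c z q r (2*d+2) = q"
  "regular_vector d c z q r (2*d+3) = r"
  "i \<le> d \<Longrightarrow> regular_vector d c z q r (2*i+1) = z ^ (d - i)"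
  "i \<le> d \<Longrightarrow> regular_vector d c z q r (2*i)
     = z ^ (2*d+1 - i) - z ^ (d+1) * (\<Sum>l<d - i. of_int (c (i + 1 + l)) * z ^ l)"
    by (auto simp: regular_vector_def)
qed

lemma regular_index_cases:
  assumes "k < 2 * (d+2)"
  obtains "k = 0" | "k = 1" | "k = 2*d+2" | "k = 2*d+3"
    | j where "j < d" "k = 2*j+2" | j where "j < d" "k = 2*j+(3::nat)"
proof -
  obtain i where "i < d+2" "k = 2*i \<or> k = 2*i+1"
    using less_double_cases[OF assms] by metis
  then show ?thesis
    by (cases i) (use that in \<open>auto simp: numeral_3_eq_3 less_Suc_eq\<close>)
qed

text \<open>By construction only the equations at the coordinates \<open>2*d+2\<close>,
  \<open>2*d+3\<close> and 0 remain; these are the three assumptions on \<open>q\<close>,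
  \<open>r\<close> and \<open>z\<close>.\<close>

lemma regular_vector_eigen:
  fixes z :: "'a :: comm_ring_1"
  assumes e: "of_int \<alpha> * z ^ (d+1) + of_int \<delta> * r = z * q"
    and f: "of_int \<beta> * z ^ (d+1) + of_int \<delta> * q = z * r"
    and cond: "z ^ (2*d+2) - 1 - (\<Sum>i<d. of_int (c (Suc i)) * (z ^ (d+2+i) - z ^ (d - i)))
      + of_int (\<alpha> * \<beta>) * z ^ (d+1) + of_int \<delta> * (of_int \<alpha> * q + of_int \<beta> * r) = 0"
    and k: "k < 2 * (d+2)"
  shows "regular_operator d c \<alpha> \<beta> \<delta> (regular_vector d c z q r) k = z * regular_vector d c z q r k"
proof -
  let ?v = "regular_vector d c z q r" and ?L = "regular_operator d c \<alpha> \<beta> \<delta>"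
  have vd: "?v (2*d) = z ^ (d+1)" by (subst regular_vector_simps) auto
  show ?thesis using k
  proof (cases rule: regular_index_cases)
    case 1
    define S where "S = (\<Sum>i<d. of_int (c (Suc i)) * z ^ (d - i))"
    define T where "T = (\<Sum>i<d. of_int (c (Suc i)) * z ^ (d+2+i))"
    have ST: "(\<Sum>i<d. of_int (c (Suc i)) * (z ^ (d+2+i) - z ^ (d - i))) = T - S"
      by (simp add: S_def T_def right_diff_distrib sum_subtractf)
    have "(\<Sum>i<d. of_int (c (Suc i)) * ?v (2*i+1)) = S"
      unfolding S_def by (intro sum.cong refl) (simp add: regular_vector_simps del: One_nat_def)
    moreover have "?v (2*d+1) = 1" by (simp add: regular_vector_simps del: One_nat_def)
    ultimately have L0: "?L ?v 0 = 1 - of_int (\<alpha> * \<beta>) * z ^ (d+1) - of_int (\<delta> * \<alpha>) * q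
        - of_int (\<delta> * \<beta>) * r - S"
      by (simp only: regular_operator_simps(1) vd regular_vector_simps(1,2))
    have v0: "?v 0 = z ^ (2*d+1) - z ^ (d+1) * (\<Sum>l<d. of_int (c (Suc l)) * z ^ l)"
      using regular_vector_simps(4)[of 0 d c z q r] by simp
    have zv: "z * ?v 0 = z ^ (2*d+2) - T"
      unfolding v0 T_def by (simp add: algebra_simps sum_distrib_left power_add)
    have "z * ?v 0 - ?L ?v 0 = 0"
      using cond unfolding zv L0 ST by (simp add: algebra_simps)
    then show ?thesis by (simp add: 1)
  next
    case 2
    have "?v 1 = z ^ d" using regular_vector_simps(3)[of 0 d c z q r] by simp
    then show ?thesis unfolding 2 regular_operator_simps(2) vd by simp
  next
    case 3
    then show ?thesis using e by (simp only: regular_operator_simps(3) vd regular_vector_simps(1,2))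
  next
    case 4
    then show ?thesis using f by (simp only: regular_operator_simps(4) vd regular_vector_simps(1,2))
  next
    case (5 j)
    have "d - j = Suc (d - Suc j)" "2*d+1-j = Suc (2*d+1 - Suc j)" using 5 by auto
    then have "?v (2*j) = z ^ Suc (2*d+1 - Suc j)
        - z ^ (d+1) * (\<Sum>l<Suc (d - Suc j). of_int (c (j + 1 + l)) * z ^ l)"
      using regular_vector_simps(4)[of j d c z q r] 5 by simp
    also have "(\<Sum>l<Suc (d - Suc j). of_int (c (j + 1 + l)) * z ^ l)
        = of_int (c (Suc j)) + z * (\<Sum>l<d - Suc j. of_int (c (Suc j + 1 + l)) * z ^ l)"
      unfolding sum.lessThan_Suc_shift by (simp add: sum_distrib_left algebra_simps)
    finally have vj: "?v (2*j) = z ^ Suc (2*d+1 - Suc j) - z ^ (d+1) * (of_int (c (Suc j))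
        + z * (\<Sum>l<d - Suc j. of_int (c (Suc j + 1 + l)) * z ^ l))" .
    have vS: "?v (2 * Suc j) = z ^ (2*d+1 - Suc j)
        - z ^ (d+1) * (\<Sum>l<d - Suc j. of_int (c (Suc j + 1 + l)) * z ^ l)"
      using 5 by (intro regular_vector_simps(4)) simp
    have "?v (2*j) + of_int (c (Suc j)) * z ^ (d+1) = z * ?v (2 * Suc j)"
      unfolding vj vS by (simp add: algebra_simps)
    then show ?thesis
      unfolding 5(2) regular_operator_simps(5)[OF 5(1)] vd by simp
  next
    case (6 j)
    have "d - j = Suc (d - Suc j)" using 6 by auto
    then show ?thesis
      unfolding 6(2) regular_operator_simps(6)[OF 6(1)]
      using 6(1) regular_vector_simps(3)[of j d c z q r] regular_vector_simps(3)[of "Suc j" d c z q r]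
      by (simp add: numeral_3_eq_3)
  qed
qed

text \<open>The second eigenvector for \<open>z = \<plusminus>1\<close>: it is the reason why double roots at \<open>\<plusminus>1\<close> do not
  spoil semisimplicity.\<close>

lemma regular_kernel_vector_eigen:
  fixes z :: "'a :: comm_ring_1"
  assumes "\<delta> * \<delta> = 1" "z * z = 1" "of_int \<alpha> + of_int (\<delta> * \<beta>) * z = 0" "k < 2 * (d+2)"
  defines "w \<equiv> \<lambda>k. if k = 2*d+2 then 1 else if k = 2*d+3 then of_int \<delta> * z else 0"
  shows "regular_operator d c \<alpha> \<beta> \<delta> w k = z * w k"
proof -
  have w: "w (2*d+2) = 1" "w (2*d+3) = of_int \<delta> * z"
    by (simp_all add: w_def)
  have w0: "w i = 0" if "i < 2*d+2" for i using that by (simp add: w_def)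
  have dd: "of_int \<delta> * of_int \<delta> = (1 :: 'a)" using assms(1) by (metis of_int_1 of_int_mult)
  show ?thesis using assms(4)
  proof (cases rule: regular_index_cases)
    case 1
    have "regular_operator d c \<alpha> \<beta> \<delta> w 0 = - (of_int \<delta> * (of_int \<alpha> + of_int (\<delta> * \<beta>) * z))"
      unfolding regular_operator_simps(1) w using w0 by (simp add: algebra_simps)
    then show ?thesis unfolding 1 assms(3) using w0 by simp
  next
    case 2
    then show ?thesis unfolding 2 regular_operator_simps(2) using w0 by simp
  next
    case 3
    have "of_int \<delta> * (of_int \<delta> * z) = z" using dd by (simp flip: mult.assoc)
    then show ?thesis unfolding 3 regular_operator_simps(3) w using w0 by simp
  next
    case 4
    have "z * (of_int \<delta> * z) = of_int \<delta>" using assms(2) by (metis mult.assoc mult.commute mult_1)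
    then show ?thesis unfolding 4 regular_operator_simps(4) w using w0 by simp
  next
    case (5 j)
    then show ?thesis unfolding 5(2) regular_operator_simps(5)[OF 5(1)] using w0 by simp
  next
    case (6 j)
    then show ?thesis unfolding 6(2) regular_operator_simps(6)[OF 6(1)] using w0 by simp
  qed
qed

section \<open>Solving for the eigenvectors at the roots\<close>

text \<open>For \<open>z\<close> = 1 or -1 the normal form makes F(z) a unit times this square.
  Hence a root satisfies the linear condition under which the second eigenvector exists.\<close>

lemma regular_square_identity:
  fixes a b e z :: "'a :: field"
  assumes "z * z = 1" "e * e = 1"
  shows "e * z * (a * b * 2 + e * (a * a + b * b) * z) = (a + e * b * z) * (a + e * b * z)"
  using assms by Groebner_Basis.algebra

text \<open>The linear system for \<open>q\<close> and \<open>r\<close> has determinant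
  \<open>z * z - 1\<close>. When this is 0 and the linear condition holds, \<open>q = 0\<close>
  still extends to a solution.\<close>

lemma regular_degenerate_identity:
  fixes a b e z Z :: "'a :: field"
  assumes "a + e * b * z = 0" "z * z = 1" "e * e = 1"
  shows "a * Z + e * (- e * a * Z) = z * 0" "b * Z + e * 0 = z * (- e * a * Z)"
    "0 + a * b * Z + e * (a * 0 + b * (- e * a * Z)) = 0"
  using assms by Groebner_Basis.algebra+

text \<open>Cramer's rule for the same system when the determinant is nonzero. The last identity
  shows that the remaining eigenvector equation, multiplied by the determinant, is F(z) = 0.\<close>

lemma regular_coefficient_identities:
  fixes a b e z Z P q r :: "'a :: field"
  assumes D: "z * z \<noteq> 1" and ee: "e * e = 1"
    and q: "q * (z * z - 1) = Z * (z * a + e * b)" and r: "r * (z * z - 1) = Z * (z * b + e * a)"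
  shows "a * Z + e * r = z * q" "b * Z + e * q = z * r"
    "(z * z - 1) * (P + a * b * Z + e * (a * q + b * r))
      = (z * z - 1) * P + Z * (a * b * (z * z + 1) + e * (a * a + b * b) * z)"
proof -
  have D: "z * z - 1 \<noteq> 0" using D by simp
  have "(z * z - 1) * (a * Z + e * r) = (z * z - 1) * (z * q)"
    using ee q r by Groebner_Basis.algebra
  with D show "a * Z + e * r = z * q" by simp
  have "(z * z - 1) * (b * Z + e * q) = (z * z - 1) * (z * r)"
    using ee q r by Groebner_Basis.algebra
  with D show "b * Z + e * q = z * r" by simp
  show "(z * z - 1) * (P + a * b * Z + e * (a * q + b * r))
      = (z * z - 1) * P + Z * (a * b * (z * z + 1) + e * (a * a + b * b) * z)"
    using ee q r by Groebner_Basis.algebra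
qed

lemma complex_poly_order_decompose:
  fixes p :: "complex poly"
  assumes "lead_coeff p = 1"
  defines "S \<equiv> SIGMA z:{z. poly p z = 0}. {..<Polynomial.order z p}"
  shows "p = (\<Prod>s\<in>S. [:- fst s, 1:])" "finite S" "card S = degree p"
proof -
  have fin: "finite {z. poly p z = 0}" using assms(1) by (intro poly_roots_finite) auto
  then show S: "finite S" by (simp add: S_def)
  have "p = (\<Prod>z|poly p z = 0. [:-z, 1:] ^ Polynomial.order z p)"
    using complex_poly_decompose[of p] assms(1) by simp
  also have "\<dots> = (\<Prod>z|poly p z = 0. \<Prod>i<Polynomial.order z p. [:-z, 1:])" by simp
  also have "\<dots> = (\<Prod>s\<in>S. [:- fst s, 1:])"
    unfolding S_def using fin by (subst prod.Sigma) (auto simp: case_prod_unfold)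
  finally show p: "p = (\<Prod>s\<in>S. [:- fst s, 1:])" .
  have "degree (\<Prod>s\<in>S. [:- fst s, 1:]) = (\<Sum>s\<in>S. degree [:- fst s, 1:])"
    by (rule degree_prod_sum_eq) auto
  then show "card S = degree p" using p by simp
qed

text \<open>Eigenvectors are indexed by a root and a position below its multiplicity. Position 0
  carries the regular vector; position 1 occurs only at 1 and -1 and carries the second eigenvector
  in the last plane.\<close>

lemma hyperbolic_realizes_regular:
  fixes F :: "int poly" and \<alpha> \<beta> \<delta> :: int
  assumes monic: "lead_coeff F = 1" and deg: "degree F = 2 * (d+2)" and dd: "\<delta> * \<delta> = 1"
    and Fz: "\<And>z :: complex. poly (map_poly of_int F) z =
      (z^2 - 1) * (z ^ (2*d+2) - 1 - (\<Sum>i<d. of_int (c (Suc i)) * (z ^ (d+2+i) - z ^ (d - i))))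
      + z ^ (d+1) * (of_int (\<alpha> * \<beta>) * (z^2 + 1) + of_int \<delta> * of_int (\<alpha>^2 + \<beta>^2) * z)"
    and simple: "\<And>z. z \<noteq> 1 \<Longrightarrow> z \<noteq> -1 \<Longrightarrow> Polynomial.order z (map_poly complex_of_int F) \<le> 1"
    and double: "Polynomial.order 1 (map_poly complex_of_int F) \<le> 2"
      "Polynomial.order (-1) (map_poly complex_of_int F) \<le> 2"
  shows "hyperbolic_realizes (d+2) F"
proof -
  let ?F = "map_poly complex_of_int F" and ?L = "regular_operator d c \<alpha> \<beta> \<delta>"
  define S where "S = (SIGMA z:{z. poly ?F z = 0}. {..<Polynomial.order z ?F})"
  have S: "?F = (\<Prod>s\<in>S. [:- fst s, 1:])" "finite S" "card S = 2 * (d+2)"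
    using complex_poly_order_decompose[of ?F] monic deg by (simp_all add: S_def coeff_map_poly)
  \<comment> \<open>In the singular case \<open>q\<close> is set to 0, which makes the coordinate
    \<open>2*d+2\<close> of the regular vector vanish.\<close>
  define q where "q z = (if z * z = 1 then 0
      else z ^ (d+1) * (z * of_int \<alpha> + of_int \<delta> * of_int \<beta>) / (z * z - 1))" for z :: complex
  define r where "r z = (if z * z = 1 then - of_int \<delta> * of_int \<alpha> * z ^ (d+1)
      else z ^ (d+1) * (z * of_int \<beta> + of_int \<delta> * of_int \<alpha>) / (z * z - 1))" for z :: complex
  define w where "w z k = (if k = 2*d+2 then 1 else if k = 2*d+3 then of_int \<delta> * z else 0)" for z :: complex and k
  define v where "v s = (if snd s = 0 then regular_vector d c (fst s) (q (fst s)) (r (fst s)) else w (fst s))"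
    for s :: "complex \<times> nat"
  \<comment> \<open>At \<open>2*d+1\<close> the regular vector is 1 and the second one 0; at
    \<open>2*d+2\<close> the second one is 1 and, for a double root, the regular one 0.\<close>
  define \<kappa> where "\<kappa> s = (if snd s = 0 then 2*d+1 else 2*d+2)" for s :: "complex \<times> nat"
  have ddC: "of_int \<delta> * of_int \<delta> = (1 :: complex)" using dd by (metis of_int_1 of_int_mult)
  have S2: "z * z = 1" "i = 1" if "(z, i) \<in> S" "i \<noteq> 0" for z i
  proof -
    have i: "i < Polynomial.order z ?F" using that(1) by (simp add: S_def)
    with that(2) simple[of z] show "z * z = 1" by (cases "z = 1 \<or> z = -1") auto
    then have "z = 1 \<or> z = -1" by (simp add: square_eq_1_iff)
    then show "i = 1" using i that(2) double by auto
  qed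
  have sq1: "of_int \<alpha> + of_int (\<delta> * \<beta>) * z = 0" if "z * z = 1" "poly ?F z = 0" for z :: complex
  proof -
    have z2: "z^2 = 1" using that(1) by (simp add: power2_eq_square)
    have "z ^ (d+1) \<noteq> 0" using that(1) by auto
    moreover have "0 = z ^ (d+1) * (of_int (\<alpha> * \<beta>) * 2 + of_int \<delta> * of_int (\<alpha>^2 + \<beta>^2) * z)"
      using Fz[of z] that(2) z2 by simp
    ultimately have "0 = of_int (\<alpha> * \<beta>) * 2 + of_int \<delta> * of_int (\<alpha>^2 + \<beta>^2) * z" by simp
    moreover have "of_int \<delta> * z * (of_int (\<alpha> * \<beta>) * 2 + of_int \<delta> * of_int (\<alpha>^2 + \<beta>^2) * z)
        = (of_int \<alpha> + of_int (\<delta> * \<beta>) * z) ^ 2"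
      using regular_square_identity[OF that(1) ddC, of "of_int \<alpha>" "of_int \<beta>"] by (simp add: power2_eq_square)
    ultimately show ?thesis by simp
  qed
  show ?thesis
  proof (rule hyperbolic_realizes_operator[of "d+2" ?L ?L S v fst \<kappa>])
    show "coordinate_linear (2 * (d+2)) (?L :: (nat \<Rightarrow> int) \<Rightarrow> _)"
      "coordinate_linear (2 * (d+2)) (?L :: (nat \<Rightarrow> complex) \<Rightarrow> _)"
      by (rule regular_operator_linear)+
    show "?L (\<lambda>k. complex_of_int (x k)) i = of_int (?L x i)" for x i
      by (simp add: regular_operator_def)
    show "pair_form (d+2) (?L x) (?L y) = pair_form (d+2) x y" for x y :: "nat \<Rightarrow> int"
      using dd by (rule regular_operator_isometry)
    show "finite S" "card S = 2 * (d+2)" "?F = (\<Prod>s\<in>S. [:- fst s, 1:])"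
      using S by blast+
    show "?L (v s) k = fst s * v s k" if sS: "s \<in> S" and k: "k < 2 * (d+2)" for s k
    proof -
      obtain z i where s: "s = (z, i)" by (cases s)
      have root: "poly ?F z = 0" using sS by (simp add: s S_def)
      show ?thesis
      proof (cases "i = 0")
        case True
        let ?Z = "z ^ (d+1)" and ?a = "complex_of_int \<alpha>" and ?b = "complex_of_int \<beta>" and ?e = "complex_of_int \<delta>"
        let ?P = "z ^ (2*d+2) - 1 - (\<Sum>i<d. of_int (c (Suc i)) * (z ^ (d+2+i) - z ^ (d - i)))"
        have "?a * ?Z + ?e * r z = z * q z \<and> ?b * ?Z + ?e * q z = z * r z
          \<and> ?P + of_int (\<alpha> * \<beta>) * ?Z + ?e * (?a * q z + ?b * r z) = 0"
        proof (cases "z * z = 1")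
          case True
          have even: "z ^ (2 * n) = 1" for n using True by (simp add: power_mult power2_eq_square)
          \<comment> \<open>Mirror exponents differ by an even number, so the antipalindromic
            \<open>?P\<close> vanishes at 1 and -1.\<close>
          have "z ^ (d+2+i) = z ^ (d - i)" if "i < d" for i
          proof -
            have "d+2+i = (d - i) + 2 * Suc i" using that by simp
            then show ?thesis using even by (metis mult.right_neutral power_add)
          qed
          moreover have "z ^ (2*d+2) = 1" using even[of "d+1"] by simp
          ultimately have P: "?P = 0" by simp
          have "?a + ?e * ?b * z = 0" using sq1[OF True root] by simp
          from regular_degenerate_identity[OF this True ddC, of ?Z] show ?thesis
            unfolding P q_def r_def if_P[OF True] of_int_mult by blast
        next
          case False
          then have D: "z * z - 1 \<noteq> 0" by simp
          have "q z * (z * z - 1) = ?Z * (z * ?a + ?e * ?b)" "r z * (z * z - 1) = ?Z * (z * ?b + ?e * ?a)"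
            using False D by (simp_all add: q_def r_def)
          note id = regular_coefficient_identities[OF False ddC this]
          have "(z * z - 1) * (?P + ?a * ?b * ?Z + ?e * (?a * q z + ?b * r z)) = poly ?F z"
            unfolding id(3) Fz by (simp add: power2_eq_square)
          then show ?thesis using id(1,2) D root by simp
        qed
        then have e: "?a * ?Z + ?e * r z = z * q z" and f: "?b * ?Z + ?e * q z = z * r z"
          and cond: "?P + of_int (\<alpha> * \<beta>) * ?Z + ?e * (?a * q z + ?b * r z) = 0" by blast+
        from regular_vector_eigen[OF e f cond k] show ?thesis
          by (simp add: s v_def True)
      next
        case False
        then have "z * z = 1" using S2 sS s by blast
        then show ?thesis
          using regular_kernel_vector_eigen[OF dd _ sq1 k] root False by (simp add: s v_def w_def[abs_def])
      qed
    qed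
    show "\<kappa> s < 2 * (d+2) \<and> v s (\<kappa> s) \<noteq> 0" if "s \<in> S" for s
      using regular_vector_simps(3)[of d d c "fst s" "q (fst s)" "r (fst s)"] by (simp add: \<kappa>_def v_def w_def)
    show "v t (\<kappa> s) = 0" if st: "s \<in> S" "t \<in> S" "s \<noteq> t" "fst s = fst t" for s t
    proof -
      obtain z i j where s: "s = (z, i)" "t = (z, j)" "i \<noteq> j"
        using st(3,4) by (cases s; cases t) auto
      show ?thesis
      proof (cases "i = 0")
        case True
        then show ?thesis using s by (simp add: v_def \<kappa>_def w_def)
      next
        case False
        then have "j = 0" "z * z = 1" using S2[of z i] S2[of z j] st s by (cases "j = 0"; auto)+
        then show ?thesis
          using False regular_vector_simps(1)[of d c z "q z" "r z"] s by (simp add: v_def \<kappa>_def q_def)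
      qed
    qed
  qed
qed

section \<open>Realization\<close>

text \<open>Multiplicity 3 leaves a root after the pair (X - e)^2 is removed; this keeps the square
  condition at \<open>e\<close> for the quotient.\<close>

lemma linear_square_factor:
  fixes F :: "int poly" and e :: int
  assumes monic: "lead_coeff F = 1" and e: "e = 1 \<or> e = -1"
    and ord: "Polynomial.order (of_int e) (map_poly complex_of_int F) \<ge> 3"
  obtains F' where "F = [:-e, 1:] * reciprocal_poly [:-e, 1:] * F'" "poly F' e = 0"
proof -
  have "Polynomial.order e F \<ge> 3"
    using ord monic by (subst (asm) order_of_int) auto
  then have "[:-e, 1:] ^ 3 dvd F"
    by (subst order_divides) simp
  then obtain H where "F = [:-e, 1:] ^ 3 * H" by blast
  then have F: "F = [:-e, 1:] * [:-e, 1:] * ([:-e, 1:] * H)"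
    by (simp only: power3_eq_cube mult.assoc)
  moreover have "reciprocal_poly [:-e, 1:] = [:-e, 1:]"
    using e by (auto simp: reciprocal_poly_def reflect_poly_pCons)
  ultimately show ?thesis using that[of "[:-e, 1:] * H"] by simp
qed

lemma hyperbolic_realizes_split:
  assumes "F = f * reciprocal_poly f * F'" "lead_coeff f = 1" "degree f > 0"
    "coeff f 0 * coeff f 0 = 1" "rsquarefree (map_poly complex_of_int f)" "degree f \<le> n"
    "hyperbolic_realizes (n - degree f) F'"
  shows "hyperbolic_realizes n F"
  using hyperbolic_realizes_mult[OF hyperbolic_realizes_dual_pair[OF assms(2-5)] assms(7)] assms(1,6)
  by simp

lemma rsquarefree_linear: "rsquarefree (map_poly complex_of_int [:-e, 1:])"
  by (auto simp: rsquarefree_roots of_int_hom.map_poly_pCons_hom pderiv_pCons)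

text \<open>Both factors have the same parity, so each of them is 2 or -2. The proof runs through
  the divisors of 4.\<close>

lemma difference_of_squares_four:
  fixes a b :: int
  assumes "(a - b) * (a + b) = 4 \<or> (a - b) * (a + b) = -4"
  shows "a * b = 0"
proof -
  define u where "u = a - b"
  have a: "a = u + b" by (simp add: u_def)
  have uv: "u * (u + 2 * b) = 4 \<or> u * (u + 2 * b) = -4" using assms by (simp add: a algebra_simps)
  then have "u dvd 4" by (metis dvd_minus_iff dvd_triv_left)
  then have "\<bar>u\<bar> \<le> 4" using dvd_imp_le_int[of 4 u] by simp
  then have "u = -4 \<or> u = -3 \<or> u = -2 \<or> u = -1 \<or> u = 0 \<or> u = 1 \<or> u = 2 \<or> u = 3 \<or> u = 4"
    by arith
  then have "u + b = 0 \<or> b = 0" using uv by (elim disjE; simp; presburger)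
  then show ?thesis by (auto simp: a)
qed

text \<open>For F = X^2 + tX + 1 the conditions read \<open>2 + t = \<delta> * a^2\<close> and
  \<open>t - 2 = \<delta> * b^2\<close>. Two squares differing by 4 include 0, so \<open>t\<close>
  is 2 or -2.\<close>

lemma palindromic_quadratic:
  fixes F :: "int poly"
  assumes monic: "lead_coeff F = 1" and pal: "reflect_poly F = F" and deg: "degree F = 2"
    and \<delta>: "\<delta> * \<delta> = 1" "poly F 1 = \<delta> * a^2" "- poly F (-1) = \<delta> * b^2"
  obtains e :: int where "e = 1 \<or> e = -1" "F = [:-e, 1:] * reciprocal_poly [:-e, 1:]"
proof -
  have "coeff F 0 = 1" using arg_cong[OF pal, of "\<lambda>p. coeff p 0"] monic by simp
  then have F: "F = [:1, coeff F 1, 1:]"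
    using deg monic by (intro poly_eqI) (auto simp: coeff_pCons coeff_eq_0 numeral_2_eq_2 split: nat.split)
  define t where "t = coeff F 1"
  have Ft: "F = [:1, t, 1:]" using F by (simp only: t_def)
  have t: "2 + t = \<delta> * a^2" "t - 2 = \<delta> * b^2"
    using \<delta>(2,3) by (simp_all add: Ft)
  have d: "\<delta> = 1 \<or> \<delta> = -1" using \<delta>(1) by (auto simp: zmult_eq_1_iff)
  have "(a - b) * (a + b) = a^2 - b^2" by (simp add: algebra_simps power2_eq_square)
  moreover have "a^2 - b^2 = 4 \<or> a^2 - b^2 = -4"
    using d
  proof
    assume "\<delta> = 1"
    with t show ?thesis by simp
  next
    assume "\<delta> = -1"
    with t show ?thesis by simp
  qed
  ultimately have "(a - b) * (a + b) = 4 \<or> (a - b) * (a + b) = -4" by simp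
  then have "a * b = 0" by (rule difference_of_squares_four)
  then have "t = 2 \<or> t = -2" using t by auto
  then show ?thesis
  proof
    assume "t = 2"
    then show ?thesis using Ft that[of "-1"] by (simp add: reciprocal_poly_def reflect_poly_pCons)
  next
    assume "t = -2"
    then show ?thesis using Ft that[of 1] by (simp add: reciprocal_poly_def reflect_poly_pCons)
  qed
qed

text \<open>Induction on \<open>n\<close>: factors \<open>f * reciprocal_poly f\<close> are split
  off while a root other than 1 and -1 is multiple, or 1 or -1 has multiplicity at least 3.
  Otherwise the regular isometry applies; it occupies at least two planes, so \<open>n = 1\<close>
  is settled by hand.\<close>

lemma hyperbolic_realizes_palindromic:
  fixes F :: "int poly"
  assumes "lead_coeff F = 1" "reflect_poly F = F" "degree F = 2 * n"
    and "\<delta> * \<delta> = 1" "poly F 1 = \<delta> * a^2" "(-1) ^ n * poly F (-1) = \<delta> * b^2"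
  shows "hyperbolic_realizes n F"
  using assms
proof (induction n arbitrary: F \<delta> a b rule: less_induct)
  case (less n)
  note monic = less.prems(1) and pal = less.prems(2) and deg = less.prems(3)
  have split: ?case if F: "F = f * reciprocal_poly f * F'" and f: "lead_coeff f = 1" "degree f > 0"
    "rsquarefree (map_poly complex_of_int f)"
    and z: "poly f 1 = 0 \<Longrightarrow> poly F' 1 = 0" "poly f (-1) = 0 \<Longrightarrow> poly F' (-1) = 0" for f F'
  proof -
    note Q = palindromic_quotient[OF monic pal deg F f(1) less.prems(4-6) z]
    obtain \<delta>' a' b' where "\<delta>' * \<delta>' = 1" "poly F' 1 = \<delta>' * a'^2"
      "(-1) ^ (n - degree f) * poly F' (-1) = \<delta>' * b'^2" using Q(6) by blast
    moreover have "n - degree f < n" using f(2) Q(2) by simp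
    ultimately have "hyperbolic_realizes (n - degree f) F'"
      using less.IH Q(3-5) by blast
    then show ?thesis using hyperbolic_realizes_split[OF F f(1,2) Q(1) f(3) Q(2)] by blast
  qed
  consider "n = 0" | "n = 1" | d where "n = d + 2"
    by (metis One_nat_def add_2_eq_Suc' not0_implies_Suc)
  then show ?case
  proof cases
    case 1
    then have "F = 1" using deg monic by (auto elim!: degree_eq_zeroE)
    then show ?thesis using 1 hyperbolic_realizes_1 by simp
  next
    case 2
    obtain e :: int where e: "e = 1 \<or> e = -1" "F = [:-e, 1:] * reciprocal_poly [:-e, 1:]"
      using palindromic_quadratic[OF monic pal _ less.prems(4,5)] less.prems(6) deg 2 by auto
    have "coeff [:-e, 1:] 0 * coeff [:-e, 1:] 0 = 1" using e(1) by auto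
    then show ?thesis
      using hyperbolic_realizes_dual_pair[of "[:-e, 1:]"] rsquarefree_linear[of e] e(2) 2 by simp
  next
    case (3 d)
    let ?o = "\<lambda>z. Polynomial.order z (map_poly complex_of_int F)"
    consider (generic) z where "z \<noteq> 1" "z \<noteq> -1" "?o z \<ge> 2" | (unit) e where "e = 1 \<or> e = (-1::int)" "?o (of_int e) \<ge> 3"
      | (regular) "\<And>z. z \<noteq> 1 \<Longrightarrow> z \<noteq> -1 \<Longrightarrow> ?o z \<le> 1" "?o 1 \<le> 2" "?o (-1) \<le> 2"
    proof -
      have "(\<exists>z. z \<noteq> 1 \<and> z \<noteq> -1 \<and> ?o z \<ge> 2) \<or> ?o (of_int 1) \<ge> 3 \<or> ?o (of_int (-1)) \<ge> 3
         \<or> (\<forall>z. z \<noteq> 1 \<longrightarrow> z \<noteq> -1 \<longrightarrow> ?o z \<le> 1) \<and> ?o 1 \<le> 2 \<and> ?o (-1) \<le> 2"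
        by (simp add: not_less_eq_eq[symmetric] numeral_2_eq_2 numeral_3_eq_3) force
      then show ?thesis using generic unit regular by metis
    qed
    then show ?thesis
    proof cases
      case generic
      obtain f F' where f: "lead_coeff f = 1" "degree f > 0" "rsquarefree (map_poly complex_of_int f)"
        "poly f 1 \<noteq> 0" "poly f (-1) \<noteq> 0" "F = f * reciprocal_poly f * F'"
        using palindromic_split_factor[OF monic pal generic(3,1,2)] .
      then show ?thesis by (intro split[of f F']) auto
    next
      case (unit e)
      obtain F' where "F = [:-e, 1:] * reciprocal_poly [:-e, 1:] * F'" "poly F' e = 0"
        using linear_square_factor[OF monic unit] .
      then show ?thesis using unit(1) by (intro split[of "[:-e, 1:]" F'] rsquarefree_linear) auto
    next
      case regular
      obtain c :: "nat \<Rightarrow> int" and \<alpha> \<beta> where nf: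
        "\<And>z :: complex. poly (map_poly of_int F) z =
          (z^2 - 1) * (z ^ (2*d+2) - 1 - (\<Sum>i<d. of_int (c (Suc i)) * (z ^ (d+2+i) - z ^ (d - i))))
          + z ^ (d+1) * (of_int (\<alpha> * \<beta>) * (z^2 + 1) + of_int \<delta> * of_int (\<alpha>^2 + \<beta>^2) * z)"
        using palindromic_normal_form[OF monic pal deg[unfolded 3] less.prems(4,5) less.prems(6)[unfolded 3]] by blast
      show ?thesis unfolding 3
        by (rule hyperbolic_realizes_regular[OF monic deg[unfolded 3] less.prems(4) nf regular])
    qed
  qed
qed

section \<open>The two possible signs of F(0)\<close>

lemma star_symmetric_int:
  fixes F :: "int poly"
  assumes "star_symmetric (map_poly rat_of_int F)"
  shows "lead_coeff F = 1" "coeff F 0 * coeff F 0 = 1" "reflect_poly F = Polynomial.smult (coeff F 0) F"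
proof -
  let ?F = "map_poly rat_of_int F" and ?r = "rat_of_int (coeff F 0)"
  have 1: "lead_coeff ?F = 1" and 2: "?r \<noteq> 0" and 3: "?F = Polynomial.smult (inverse ?r) (reflect_poly ?F)"
    using assms by (simp_all add: star_symmetric_def poly_0_coeff_0)
  then show "lead_coeff F = 1" by simp
  \<comment> \<open>For monic \<open>F\<close> the reflection has constant coefficient 1.\<close>
  then have "?r = inverse ?r" using arg_cong[OF 3, of "\<lambda>p. coeff p 0"] by simp
  then have rr: "?r * ?r = 1" using 2 by (metis right_inverse)
  then show "coeff F 0 * coeff F 0 = 1" by (metis of_int_1 of_int_eq_iff of_int_mult)
  have "Polynomial.smult ?r ?F = reflect_poly ?F"
    using 2 by (subst 3) simp
  then have "map_poly rat_of_int (Polynomial.smult (coeff F 0) F) = map_poly of_int (reflect_poly F)"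
    by (simp add: of_int_hom.map_poly_hom_smult map_poly_of_int_reflect)
  then show "reflect_poly F = Polynomial.smult (coeff F 0) F" by simp
qed

text \<open>Antisymmetry in even degree forces roots at 1 and -1, and multiplicity 1 is excluded, so
  (X^2 - 1)^2 divides \<open>F\<close>. Removing one factor X^2 - 1 leaves a palindromic
  \<open>F'\<close> that vanishes at 1 and -1, where the square conditions hold with
  \<open>a\<close> = \<open>b\<close> = 0.\<close>

lemma hyperbolic_realizes_antipalindromic:
  fixes F :: "int poly"
  assumes monic: "lead_coeff F = 1" and anti: "reflect_poly F = - F" and deg: "degree F = 2 * n"
    and "Polynomial.order 1 F \<noteq> 1" "Polynomial.order (-1) F \<noteq> 1"
  shows "hyperbolic_realizes n F"
proof -
  have F0: "F \<noteq> 0" using monic by auto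
  have root: "poly F e = 0" if "e = 1 \<or> e = -1" for e
    using poly_reflect_poly_unit[of e F] that anti deg by auto
  have ord: "2 \<le> Polynomial.order e F" if "e = 1 \<or> e = -1" for e
    using root[OF that] that assms(4,5) F0 by (auto simp: order_root)
  have "[:-1, 1:] ^ 2 dvd F" using ord[of 1] by (subst order_divides) simp
  then obtain G where G: "F = [:-1, 1:] ^ 2 * G" by blast
  have "Polynomial.order (-1) F = Polynomial.order (-1) ([:-1, 1 :: int:] ^ 2) + Polynomial.order (-1) G"
    using F0 unfolding G by (rule order_mult)
  moreover have "Polynomial.order (-1) ([:-1, 1 :: int:] ^ 2) = 0" by (rule order_0I) simp
  ultimately have "2 \<le> Polynomial.order (-1) G" using ord[of "-1"] by simp
  then have "[:1, 1:] ^ 2 dvd G" using order_divides[of "-1" 2 G] by simp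
  then obtain H where H: "G = [:1, 1:] ^ 2 * H" by blast
  define F' where "F' = [:-1, 0, 1:] * H"
  have FF': "F = [:-1, 0, 1:] * F'"
  proof -
    have "[:-1, 1:] * [:1, 1:] = [:-1, 0, 1 :: int:]" by simp
    then have "[:-1, 0, 1:] * F' = ([:-1, 1:] * [:1, 1:]) * (([:-1, 1:] * [:1, 1:]) * H)"
      by (simp only: F'_def)
    also have "\<dots> = F" unfolding G H by (simp only: power2_eq_square ac_simps)
    finally show ?thesis ..
  qed
  have F'0: "F' \<noteq> 0" using FF' F0 by auto
  have "2 * n = 2 + degree F'" using deg F'0 unfolding FF' by (subst (asm) degree_mult_eq) auto
  then have m: "n = Suc (n - 1)" "degree F' = 2 * (n - 1)" by auto
  define m where "m = n - 1"
  note m = m[folded m_def]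
  have "lead_coeff F' = 1" using monic unfolding FF' lead_coeff_mult by simp
  moreover have "reflect_poly F' = F'"
  proof -
    have "reflect_poly [:-1, 0, 1 :: int:] = - [:-1, 0, 1:]" by (simp add: reflect_poly_pCons)
    then have "[:-1, 0, 1:] * reflect_poly F' = [:-1, 0, 1:] * F'"
      using anti unfolding FF' reflect_poly_mult by (simp only: mult_minus_left neg_equal_iff_equal)
    then show ?thesis unfolding mult_cancel_left by simp
  qed
  moreover have "poly F' 1 = 1 * 0^2" "(-1) ^ m * poly F' (-1) = 1 * 0^2"
    by (simp_all add: F'_def)
  ultimately have "hyperbolic_realizes m F'"
    using hyperbolic_realizes_palindromic[of F' m 1 0 0] m(2) by simp
  then show ?thesis
    using hyperbolic_realizes_mult[OF hyperbolic_realizes_swap, of m F'] by (simp only: FF' m(1) plus_1_eq_Suc)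
qed

text \<open>A square product forbids opposite signs; this supplies the common \<delta> of F(1) and
  (-1)^n F(-1).\<close>

lemma exists_square_class_sign:
  fixes x y :: int
  assumes "\<exists>a. \<bar>x\<bar> = a^2" "\<exists>b. \<bar>y\<bar> = b^2" "\<exists>c. x * y = c^2"
  shows "\<exists>\<delta> a b. \<delta> * \<delta> = 1 \<and> x = \<delta> * a^2 \<and> y = \<delta> * b^2"
proof -
  obtain a b where ab: "\<bar>x\<bar> = a^2" "\<bar>y\<bar> = b^2" using assms(1,2) by blast
  have "x * y \<ge> 0" using assms(3) by auto
  then have "(x \<ge> 0 \<and> y \<ge> 0) \<or> (x \<le> 0 \<and> y \<le> 0)" by (simp add: zero_le_mult_iff)
  then show ?thesis
  proof
    assume "x \<ge> 0 \<and> y \<ge> 0"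
    then show ?thesis using ab by (intro exI[of _ 1] exI[of _ a] exI[of _ b]) auto
  next
    assume "x \<le> 0 \<and> y \<le> 0"
    then show ?thesis using ab by (intro exI[of _ "-1"] exI[of _ a] exI[of _ b]) auto
  qed
qed

theorem theorem1p2:
  fixes F :: "int poly" and n :: nat
  assumes "star_symmetric (map_poly rat_of_int F)"
    and "degree F = 2 * n"
    and "\<exists>a::int. \<bar>poly F 1\<bar> = a\<^sup>2"
    and "\<exists>b::int. \<bar>poly F (- 1)\<bar> = b\<^sup>2"
    and "\<exists>c::int. (- 1) ^ n * poly F 1 * poly F (- 1) = c\<^sup>2"
    and "Polynomial.order 1 F \<noteq> 1"
    and "Polynomial.order (- 1) F \<noteq> 1"
  shows "\<exists>G A :: int mat.
           even_unimodular G \<and> has_signature G n n \<and>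
           lattice_isometry G A \<and> semisimple_endo A \<and> char_poly A = F"
proof -
  note F = star_symmetric_int[OF assms(1)]
  have "coeff F 0 = 1 \<or> coeff F 0 = -1" using F(2) by (auto simp: zmult_eq_1_iff)
  then have "hyperbolic_realizes n F"
  proof
    assume "coeff F 0 = 1"
    then have "reflect_poly F = F" using F(3) by simp
    moreover have "\<bar>(-1) ^ n * poly F (-1)\<bar> = \<bar>poly F (-1)\<bar>" by (simp add: abs_mult)
    then obtain \<delta> a b where "\<delta> * \<delta> = 1" "poly F 1 = \<delta> * a^2" "(-1) ^ n * poly F (-1) = \<delta> * b^2"
      using exists_square_class_sign[of "poly F 1" "(-1) ^ n * poly F (-1)"] assms(3-5) by (auto simp: ac_simps)
    ultimately show ?thesis using hyperbolic_realizes_palindromic F(1) assms(2) by blast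
  next
    assume "coeff F 0 = -1"
    then have "reflect_poly F = - F" using F(3) by simp
    then show ?thesis using hyperbolic_realizes_antipalindromic F(1) assms(2,6,7) by blast
  qed
  then obtain A where "hyperbolic_isometry n A" "semisimple_endo A" "char_poly A = F"
    by (auto simp: hyperbolic_realizes_def)
  then show ?thesis
    using hyperbolic_even_unimodular hyperbolic_signature hyperbolic_isometry_imp_lattice_isometry by blast
qed

end
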